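(* The operation $\oplus_\Delta$ makes $\Omega$ into an abelian Lie group, and the map $\mathrm{Log}_\Delta:(\Omega,\oplus_\Delta)\to(V,+)$ is a Lie group isomorphism. Moreover, for all $a,x,y\in\Omega$ and $0\le t\le1$, $$a\oplus_\Delta(x\odot_{\Delta,t}y)=(a\oplus_\Delta x)\odot_{\Delta,t}(a\oplus_\Delta y),$$ $$d_\Delta(a\oplus_\Delta x,a\oplus_\Delta y)=d_\Delta(x,y),$$ and $$(x\odot_{\Delta,t}y)^{-\Delta}=x^{-\Delta}\odot_{\Delta,t}y^{-\Delta}.$$
   Context: Let $V\subset \mathrm{Sym}(3,\mathbb{R})$ be the 5-dimensional space of real symmetric $3\times3$ matrices whose $(1,2)$ and $(2,1)$ entries are $0$, and let $\Omega\subset V$ be the open cone of positive definite matrices in $V$. Each $x\in\Omega$ has a unique lower triangular Cholesky factor $T_x$ with positive diagonal and $x=T_xT_x^{\top}$. For $v\in V$ let $\underline{v}$ be the unique lower triangular matrix with $v=\underline v+\underline v^{\top}$. The clan product on $V$ is $u\Delta w=\underline u\,w+w\,\underline u^{\top}$, $L_u(w)=u\Delta w$, and $Q_\Delta(u,v)=\mathrm{tr}(L_{u\Delta v})$, an inner product on $V$. The clan exponential $\mathrm{Exp}_\Delta:V\to\Omega$, $\mathrm{Exp}_\Delta(v)=\exp(\underline v)\exp(\underline v)^{\top}$, is a diffeomorphism with inverse $\mathrm{Log}_\Delta(x)=\log(T_x)+\log(T_x)^{\top}$ (principal logarithm). For $x,y\in\Omega$, $0\le t\le1$: $x\odot_{\Delta,t}y:=\mathrm{Exp}_\Delta\bigl((1-t)\mathrm{Log}_\Delta(x)+t\,\mathrm{Log}_\Delta(y)\bigr)$,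 $x\oplus_\Delta y:=\mathrm{Exp}_\Delta\bigl(\mathrm{Log}_\Delta(x)+\mathrm{Log}_\Delta(y)\bigr)$, $x^{-\Delta}:=\mathrm{Exp}_\Delta\bigl(-\mathrm{Log}_\Delta(x)\bigr)$. $d_\Delta$ is the Riemannian distance of the metric $g^\Delta_x(u,v)=Q_\Delta\bigl((d\mathrm{Log}_\Delta)_xu,(d\mathrm{Log}_\Delta)_xv\bigr)$; it satisfies $d_\Delta(x,y)=Q_\Delta(\xi,\xi)^{1/2}$ with $\xi=\mathrm{Log}_\Delta(x)-\mathrm{Log}_\Delta(y)$. *)

theory Defs
  imports "HOL-Analysis.Analysis" "HOL-Algebra.Group"
begin

section \<open>Smooth maps and Lie groups on open subsets of linear subspaces\<close>

text \<open>\<open>C\<^sup>k\<close> maps on an open set: all iterated directional derivatives up to order \<open>k\<close> exist and are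
  continuous, each intermediate one being Frechet differentiable.\<close>

primrec Ck_on :: "nat \<Rightarrow> 'a::real_normed_vector set \<Rightarrow> ('a \<Rightarrow> 'b::real_normed_vector) \<Rightarrow> bool" where
  "Ck_on 0 U f \<longleftrightarrow> continuous_on U f"
| "Ck_on (Suc k) U f \<longleftrightarrow>
     (\<forall>x\<in>U. f differentiable (at x)) \<and> (\<forall>v. Ck_on k U (\<lambda>x. frechet_derivative f (at x) v))"

text \<open>Smoothness of a map defined on an arbitrary subset of a Euclidean space: locally, it is the
  restriction of a \<open>C\<^sup>\<infinity>\<close> map on an open set of the ambient space. If \<open>S\<close> is open in a linear subspace
  \<open>W\<close>, this is smoothness on \<open>S\<close> as an open subset of the vector space \<open>W\<close>.\<close>

definition smooth_map_on :: "'a::euclidean_space set \<Rightarrow> ('a \<Rightarrow> 'b::euclidean_space) \<Rightarrow> bool" where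
  "smooth_map_on S f \<longleftrightarrow>
     (\<forall>x\<in>S. \<exists>U g. open U \<and> x \<in> U \<and> (\<forall>k. Ck_on k U g) \<and> (\<forall>y\<in>S \<inter> U. g y = f y))"

text \<open>A Lie group whose underlying manifold is an open subset of the vector space \<open>W\<close>.\<close>

definition lie_group_in :: "'a::euclidean_space set \<Rightarrow> 'a monoid \<Rightarrow> bool" where
  "lie_group_in W G \<longleftrightarrow>
     subspace W \<and> openin (top_of_set W) (carrier G) \<and> group G \<and>
     smooth_map_on (carrier G \<times> carrier G) (\<lambda>(x, y). x \<otimes>\<^bsub>G\<^esub> y) \<and>
     smooth_map_on (carrier G) (\<lambda>x. inv\<^bsub>G\<^esub> x)"

definition abelian_lie_group_in :: "'a::euclidean_space set \<Rightarrow> 'a monoid \<Rightarrow> bool" where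
  "abelian_lie_group_in W G \<longleftrightarrow> lie_group_in W G \<and> comm_group G"

definition lie_group_iso ::
  "'a::euclidean_space set \<Rightarrow> 'a monoid \<Rightarrow> 'b::euclidean_space set \<Rightarrow> 'b monoid \<Rightarrow> ('a \<Rightarrow> 'b) \<Rightarrow> bool" where
  "lie_group_iso W G W' H f \<longleftrightarrow>
     lie_group_in W G \<and> lie_group_in W' H \<and> f \<in> iso G H \<and>
     smooth_map_on (carrier G) f \<and> smooth_map_on (carrier H) (inv_into (carrier G) f)"


section \<open>Riemannian distance\<close>

text \<open>Infimum of the lengths of piecewise \<open>C\<^sup>1\<close> curves in \<open>S\<close> from \<open>x\<close> to \<open>y\<close>. The library's notion of
  piecewise \<open>C\<^sup>1\<close> allows the velocity to be unbounded near the finitely many exceptional points;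
  the relation \<open>has_integral\<close> discards the curves of infinite length.\<close>

definition riemannian_dist ::
  "'a::euclidean_space set \<Rightarrow> ('a \<Rightarrow> 'a \<Rightarrow> 'a \<Rightarrow> real) \<Rightarrow> 'a \<Rightarrow> 'a \<Rightarrow> real" where
  "riemannian_dist S g x y = Inf {l. \<exists>\<gamma>.
     \<gamma> piecewise_C1_differentiable_on {0..1} \<and> path_image \<gamma> \<subseteq> S \<and>
     pathstart \<gamma> = x \<and> pathfinish \<gamma> = y \<and>
     ((\<lambda>t. sqrt (g (\<gamma> t) (vector_derivative \<gamma> (at t)) (vector_derivative \<gamma> (at t))))
        has_integral l) {0..1}}"


section \<open>Matrix functions and traces\<close>

definition matrix_exp :: "real^'n^'n \<Rightarrow> real^'n^'n" where
  "matrix_exp A = (\<Sum>k. (((**) A) ^^ k) (mat 1) /\<^sub>R fact k)"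

definition complex_eigenvalue :: "real^'n^'n \<Rightarrow> complex \<Rightarrow> bool" where
  "complex_eigenvalue A \<mu> \<longleftrightarrow>
     (\<exists>z::complex^'n. z \<noteq> 0 \<and> (\<chi> i j. complex_of_real (A $ i $ j)) *v z = \<mu> *s z)"

text \<open>The principal logarithm of a real matrix without eigenvalues in \<open>(-\<infinity>, 0]\<close>: the unique logarithm
  with spectrum in the strip \<open>-\<pi> < Im z < \<pi>\<close>; it is real.\<close>

definition matrix_log :: "real^'n^'n \<Rightarrow> real^'n^'n" where
  "matrix_log A = (THE X. matrix_exp X = A \<and>
     (\<forall>\<mu>. complex_eigenvalue X \<mu> \<longrightarrow> - pi < Im \<mu> \<and> Im \<mu> < pi))"

text \<open>Trace of an endomorphism \<open>f\<close> of a finite-dimensional subspace \<open>W\<close>; it does not depend on the basis.\<close>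

definition trace_on :: "'a::real_vector set \<Rightarrow> ('a \<Rightarrow> 'a) \<Rightarrow> real" where
  "trace_on W f =
     (let B = (SOME B. independent B \<and> span B = W) in \<Sum>b\<in>B. representation B (f b) b)"


section \<open>The clan and its operations\<close>

definition clan_space :: "(real^3^3) set" where
  "clan_space = {v. transpose v = v \<and> v $ 1 $ 2 = 0 \<and> v $ 2 $ 1 = 0}"

definition clan_cone :: "(real^3^3) set" where
  "clan_cone = {x \<in> clan_space. \<forall>z. z \<noteq> 0 \<longrightarrow> 0 < z \<bullet> (x *v z)}"

text \<open>Written out because the order on the index type \<open>3\<close> is that of residues modulo 3, so that
  \<open>3 = 0 < 1 < 2\<close>.\<close>

definition lower_triangular :: "real^3^3 \<Rightarrow> bool" where
  "lower_triangular L \<longleftrightarrow> L $ 1 $ 2 = 0 \<and> L $ 1 $ 3 = 0 \<and> L $ 2 $ 3 = 0"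

definition cholesky :: "real^3^3 \<Rightarrow> real^3^3" where
  "cholesky x = (THE T. lower_triangular T \<and> (\<forall>i. 0 < T $ i $ i) \<and> x = T ** transpose T)"

definition lower_part :: "real^3^3 \<Rightarrow> real^3^3" where
  "lower_part v = (THE L. lower_triangular L \<and> v = L + transpose L)"

definition clan_prod :: "real^3^3 \<Rightarrow> real^3^3 \<Rightarrow> real^3^3" where
  "clan_prod u w = lower_part u ** w + w ** transpose (lower_part u)"

definition clan_Q :: "real^3^3 \<Rightarrow> real^3^3 \<Rightarrow> real" where
  "clan_Q u v = trace_on clan_space (clan_prod (clan_prod u v))"

definition clan_Exp :: "real^3^3 \<Rightarrow> real^3^3" where
  "clan_Exp v = matrix_exp (lower_part v) ** transpose (matrix_exp (lower_part v))"

definition clan_Log :: "real^3^3 \<Rightarrow> real^3^3" where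
  "clan_Log x = matrix_log (cholesky x) + transpose (matrix_log (cholesky x))"

definition clan_mean :: "real \<Rightarrow> real^3^3 \<Rightarrow> real^3^3 \<Rightarrow> real^3^3" where
  "clan_mean t x y = clan_Exp ((1 - t) *\<^sub>R clan_Log x + t *\<^sub>R clan_Log y)"

definition clan_add :: "real^3^3 \<Rightarrow> real^3^3 \<Rightarrow> real^3^3" where
  "clan_add x y = clan_Exp (clan_Log x + clan_Log y)"

definition clan_inv :: "real^3^3 \<Rightarrow> real^3^3" where
  "clan_inv x = clan_Exp (- clan_Log x)"

text \<open>Since the cone is open in \<open>clan_space\<close>, the derivative within the cone is determined on
  \<open>clan_space\<close>, the tangent space at every point; its values elsewhere are irrelevant.\<close>

definition clan_metric :: "real^3^3 \<Rightarrow> real^3^3 \<Rightarrow> real^3^3 \<Rightarrow> real" where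
  "clan_metric x u v =
     clan_Q (frechet_derivative clan_Log (at x within clan_cone) u)
            (frechet_derivative clan_Log (at x within clan_cone) v)"

definition clan_dist :: "real^3^3 \<Rightarrow> real^3^3 \<Rightarrow> real" where
  "clan_dist = riemannian_dist clan_cone clan_metric"

definition clan_cone_group :: "(real^3^3) monoid" where
  "clan_cone_group = \<lparr>carrier = clan_cone, mult = clan_add, one = mat 1\<rparr>"

definition clan_space_group :: "(real^3^3) monoid" where
  "clan_space_group = \<lparr>carrier = clan_space, mult = (+), one = 0\<rparr>"

end

theory Submission
  imports Defs "HOL-Computational_Algebra.Fundamental_Theorem_Algebra"
begin

text \<open>\<open>clan_Log\<close> is a bijection from the cone onto the vector space with inverse \<open>clan_Exp\<close>, and both are
  restrictions of explicit smooth maps: the Cholesky factors are lower triangular with vanishing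
  \<open>(2,1)\<close> entry, and on such matrices the exponential and the logarithm are given by exponentials and
  divided differences of \<open>exp\<close>. The group structure and the identities are transported from the vector
  space. Along a curve \<open>\<gamma>\<close> in the cone the speed is the \<open>clan_Q\<close>-length of the velocity of
  \<open>clan_Log \<circ> \<gamma>\<close>, and translation by \<open>a\<close> only adds the constant \<open>clan_Log a\<close> to the latter curve.\<close>

section \<open>Calculus of \<open>C\<^sup>k\<close> maps\<close>

text \<open>The main obstacle is \<open>matrix_log\<close>: it is singled out among all real
  matrices with spectrum in the strip, so a competitor \<open>X\<close> with
  \<open>matrix_exp X = matrix_exp A\<close> need not be triangular. It does commute with its own
  exponential, hence with every polynomial in \<open>matrix_exp A\<close>. Since an arrow matrix
  \<open>A\<close> is such a polynomial, \<open>X\<close> and \<open>A\<close> commute. Both have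
  real spectrum, and a common complex eigenvector then forces \<open>X = A\<close>; the divided
  differences are the factors that must not vanish in this argument. The second obstacle is that
  \<open>clan_Exp\<close> and \<open>clan_Log\<close> are meaningful only on sets with empty
  interior in the space of all matrices, while smoothness requires open neighbourhoods there. The
  coordinate formulas therefore read only five entries of a matrix and ignore symmetry.\<close>

lemma Ck_on_SucI:
  assumes "\<And>x. x \<in> U \<Longrightarrow> (f has_derivative f' x) (at x)"
    and "\<And>v. Ck_on k U (\<lambda>x. frechet_derivative f (at x) v)"
  shows "Ck_on (Suc k) U f"
  using assms by (auto simp: differentiable_def)

text \<open>On an open set, agreement of the functions gives agreement near each point, hence the
  same \<open>frechet_derivative\<close>; the values off \<open>U\<close> may differ.\<close>

lemma Ck_on_cong:
  assumes "open U" "\<And>x. x \<in> U \<Longrightarrow> f x = g x" "Ck_on k U f"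
  shows "Ck_on k U g"
  using assms(2,3)
proof (induction k arbitrary: f g)
  case 0
  then show ?case by (auto cong: continuous_on_cong)
next
  case (Suc k)
  have eq: "frechet_derivative f (at x) = frechet_derivative g (at x)" if "x \<in> U" for x
    using Suc.prems assms(1) that by (intro frechet_derivative_transform_within_open[of _ _ U]) auto
  have "g differentiable at x" if "x \<in> U" for x
    using Suc.prems assms(1) that unfolding differentiable_def Ck_on.simps
    by (metis has_derivative_transform_within_open)
  moreover have "Ck_on k U (\<lambda>x. frechet_derivative g (at x) v)" for v
    by (rule Suc.IH[of "\<lambda>x. frechet_derivative f (at x) v"]) (use Suc.prems eq in auto)
  ultimately show ?case by simp
qed

text \<open>Replaces the derivative selected by choice by an explicit formula \<open>f'\<close>; the
  closure rules below are inductions that use it.\<close>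

lemma Ck_on_derivI:
  assumes "open U" "\<And>x. x \<in> U \<Longrightarrow> (f has_derivative f' x) (at x)"
    and "\<And>v. Ck_on k U (\<lambda>x. f' x v)"
  shows "Ck_on (Suc k) U f"
proof (rule Ck_on_SucI[OF assms(2)])
  fix v
  show "Ck_on k U (\<lambda>x. frechet_derivative f (at x) v)"
    by (rule Ck_on_cong[OF assms(1) _ assms(3)[of v]]) (metis assms(2) frechet_derivative_at)
qed

lemma Ck_on_has_derivative:
  assumes "Ck_on (Suc k) U f" "x \<in> U"
  shows "(f has_derivative frechet_derivative f (at x)) (at x)"
  using assms frechet_derivative_works by auto

lemma Ck_on_Suc_imp: "Ck_on (Suc k) U f \<Longrightarrow> Ck_on k U f"
proof (induction k arbitrary: f)
  case 0
  then show ?case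
    by (auto intro!: continuous_at_imp_continuous_on differentiable_imp_continuous_within)
qed (auto)

lemma Ck_on_subset:
  assumes "Ck_on k V f" "U \<subseteq> V"
  shows "Ck_on k U f"
  using assms(1)
proof (induction k arbitrary: f)
  case 0
  then show ?case using assms(2) continuous_on_subset by auto
next
  case (Suc k)
  then show ?case using assms(2) by auto
qed

lemma Ck_on_const: "Ck_on k U (\<lambda>x. c)"
  by (induction k arbitrary: c) auto

lemma Ck_on_bounded_linear:
  assumes "open U" "bounded_linear h" "Ck_on k U f"
  shows "Ck_on k U (\<lambda>x. h (f x))"
  using assms(3)
proof (induction k arbitrary: f)
  case 0
  then show ?case by (auto intro: bounded_linear.continuous_on[OF assms(2)])
next
  case (Suc k)
  show ?case
    by (rule Ck_on_derivI[OF assms(1), where f' = "\<lambda>x v. h (frechet_derivative f (at x) v)"])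
      (use Suc bounded_linear.has_derivative[OF assms(2) Ck_on_has_derivative[OF Suc.prems]] in auto)
qed

lemma Ck_on_id: "open U \<Longrightarrow> Ck_on k U (\<lambda>x. x)"
proof (induction k)
  case (Suc k)
  show ?case
    by (rule Ck_on_derivI[OF Suc.prems, where f' = "\<lambda>x v. v"]) (auto intro: Ck_on_const)
qed auto

lemma Ck_on_linear: "open U \<Longrightarrow> bounded_linear h \<Longrightarrow> Ck_on k U h"
  using Ck_on_bounded_linear[OF _ _ Ck_on_id] by blast

lemma Ck_on_add:
  assumes "open U" "Ck_on k U f" "Ck_on k U g"
  shows "Ck_on k U (\<lambda>x. f x + g x)"
  using assms(2,3)
proof (induction k arbitrary: f g)
  case (Suc k)
  show ?case
  proof (rule Ck_on_derivI[OF assms(1)])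
    show "((\<lambda>x. f x + g x) has_derivative
        (\<lambda>v. frechet_derivative f (at x) v + frechet_derivative g (at x) v)) (at x)" if "x \<in> U" for x
      using has_derivative_add[OF Ck_on_has_derivative[OF Suc.prems(1) that]
          Ck_on_has_derivative[OF Suc.prems(2) that]] .
    show "Ck_on k U (\<lambda>x. frechet_derivative f (at x) v + frechet_derivative g (at x) v)" for v
      by (rule Suc.IH) (use Suc.prems in auto)
  qed
qed (simp add: continuous_on_add)

lemma Ck_on_sum:
  assumes "open U" "\<And>i. i \<in> I \<Longrightarrow> Ck_on k U (f i)"
  shows "Ck_on k U (\<lambda>x. \<Sum>i\<in>I. f i x)"
  using assms(2)
  by (induction I rule: infinite_finite_induct) (simp_all add: Ck_on_const Ck_on_add assms(1))

lemma Ck_on_bilinear: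
  assumes "open U" "bounded_bilinear h" "Ck_on k U f" "Ck_on k U g"
  shows "Ck_on k U (\<lambda>x. h (f x) (g x))"
  using assms(3,4)
proof (induction k arbitrary: f g)
  case 0
  then show ?case by (auto intro: bounded_bilinear.continuous_on[OF assms(2)])
next
  case (Suc k)
  have D: "Ck_on k U (\<lambda>x. frechet_derivative f (at x) v)" "Ck_on k U (\<lambda>x. frechet_derivative g (at x) v)" for v
    using Suc.prems by auto
  show ?case
  proof (rule Ck_on_derivI[OF assms(1)])
    show "((\<lambda>x. h (f x) (g x)) has_derivative (\<lambda>v. h (f x) (frechet_derivative g (at x) v) +
        h (frechet_derivative f (at x) v) (g x))) (at x)" if "x \<in> U" for x
      using bounded_bilinear.FDERIV[OF assms(2) Ck_on_has_derivative[OF Suc.prems(1) that]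
          Ck_on_has_derivative[OF Suc.prems(2) that]] .
    show "Ck_on k U (\<lambda>x. h (f x) (frechet_derivative g (at x) v) +
        h (frechet_derivative f (at x) v) (g x))" for v
      by (intro Ck_on_add assms(1) Suc.IH D Ck_on_Suc_imp[OF Suc.prems(1)] Ck_on_Suc_imp[OF Suc.prems(2)])
  qed
qed

lemmas Ck_on_mult = Ck_on_bilinear[OF _ bounded_bilinear_mult]
lemmas Ck_on_scaleR = Ck_on_bilinear[OF _ bounded_bilinear_scaleR]
lemmas Ck_on_minus = Ck_on_bounded_linear[OF _ bounded_linear_minus[OF bounded_linear_ident]]

lemma Ck_on_diff:
  assumes "open U" "Ck_on k U f" "Ck_on k U g"
  shows "Ck_on k U (\<lambda>x. f x - g x)"
  using Ck_on_add[OF assms(1,2) Ck_on_minus[OF assms(1,3)]] by simp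

text \<open>In the chain rule both the base point and the direction of the outer derivative vary
  with \<open>x\<close>, whereas \<open>Ck_on\<close> controls derivatives in fixed directions.
  Expanding the direction in \<open>Basis\<close> gives a finite sum of products to which the
  induction hypothesis applies.\<close>

lemma Ck_on_compose:
  fixes f :: "'a::real_normed_vector \<Rightarrow> 'b::euclidean_space" and g :: "'b \<Rightarrow> 'c::real_normed_vector"
  assumes "open U" "Ck_on k V g" "Ck_on k U f" "f ` U \<subseteq> V"
  shows "Ck_on k U (\<lambda>x. g (f x))"
  using assms(2,3)
proof (induction k arbitrary: g)
  case 0
  then show ?case using continuous_on_compose2[of V g U f] assms(4) by simp
next
  case (Suc k)
  have fV: "f x \<in> V" if "x \<in> U" for x using assms(4) that by auto
  show ?case
  proof (rule Ck_on_derivI[OF assms(1), where f' = "\<lambda>x v. \<Sum>b\<in>Basis.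
      (frechet_derivative f (at x) v \<bullet> b) *\<^sub>R frechet_derivative g (at (f x)) b"])
    fix x assume x: "x \<in> U"
    let ?F = "frechet_derivative f (at x)" and ?G = "frechet_derivative g (at (f x))"
    have "(g has_derivative ?G) (at (f x))"
      using Ck_on_has_derivative[OF Suc.prems(1) fV[OF x]] .
    then have "linear ?G" by (rule has_derivative_linear)
    have eq: "?G w = (\<Sum>b\<in>Basis. (w \<bullet> b) *\<^sub>R ?G b)" for w
      using linear_sum[OF \<open>linear ?G\<close>, of "\<lambda>b. (w \<bullet> b) *\<^sub>R b" Basis]
      by (simp add: linear_cmul[OF \<open>linear ?G\<close>] euclidean_representation)
    have "((\<lambda>x. g (f x)) has_derivative (\<lambda>v. ?G (?F v))) (at x)"
      using diff_chain_at[OF Ck_on_has_derivative[OF Suc.prems(2) x] Ck_on_has_derivative[OF Suc.prems(1) fV[OF x]]]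
      by (simp add: o_def)
    then show "((\<lambda>x. g (f x)) has_derivative (\<lambda>v. \<Sum>b\<in>Basis. (?F v \<bullet> b) *\<^sub>R ?G b)) (at x)"
      by (simp only: eq[symmetric])
  next
    fix v
    show "Ck_on k U (\<lambda>x. \<Sum>b\<in>Basis.
      (frechet_derivative f (at x) v \<bullet> b) *\<^sub>R frechet_derivative g (at (f x)) b)"
    proof (intro Ck_on_sum Ck_on_scaleR assms(1))
      fix b :: 'b
      show "Ck_on k U (\<lambda>x. frechet_derivative f (at x) v \<bullet> b)"
        by (rule Ck_on_bounded_linear[OF assms(1) bounded_linear_inner_left]) (use Suc.prems(2) in simp)
      show "Ck_on k U (\<lambda>x. frechet_derivative g (at (f x)) b)"
        by (rule Suc.IH[OF _ Ck_on_Suc_imp[OF Suc.prems(2)]]) (use Suc.prems(1) in simp)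
    qed
  qed
qed

lemma Ck_on_field_derivI:
  fixes f f' :: "real \<Rightarrow> real"
  assumes "open U" "\<And>x. x \<in> U \<Longrightarrow> (f has_field_derivative f' x) (at x)" "Ck_on k U f'"
  shows "Ck_on (Suc k) U f"
proof (rule Ck_on_derivI[OF assms(1)])
  show "(f has_derivative (\<lambda>v. f' x * v)) (at x)" if "x \<in> U" for x
    using assms(2)[OF that] by (simp add: has_field_derivative_def)
  show "Ck_on k U (\<lambda>x. f' x * v)" for v
    by (rule Ck_on_mult[OF assms(1,3) Ck_on_const])
qed

section \<open>Smoothness of elementary functions and power series\<close>

lemma Ck_on_inverse: "Ck_on k (- {0}) (inverse :: real \<Rightarrow> real)"
proof (induction k)
  case (Suc k)
  show ?case
  proof (rule Ck_on_field_derivI)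
    show "(inverse has_field_derivative - (inverse x * inverse x)) (at x)" if "x \<in> - {0}" for x :: real
      using DERIV_inverse[of x] that by (simp add: power2_eq_square)
    show "Ck_on k (- {0}) (\<lambda>x :: real. - (inverse x * inverse x))"
      by (intro Ck_on_minus Ck_on_mult Suc) auto
  qed auto
qed (auto intro!: continuous_intros)

lemma Ck_on_exp: "Ck_on k UNIV (exp :: real \<Rightarrow> real)"
proof (induction k)
  case (Suc k)
  then show ?case by (rule Ck_on_field_derivI[OF open_UNIV DERIV_exp])
qed (auto intro!: continuous_intros)

lemma Ck_on_ln: "Ck_on k {0<..} (ln :: real \<Rightarrow> real)"
proof (cases k)
  case (Suc j)
  have "Ck_on j {0<..} (inverse :: real \<Rightarrow> real)"
    by (rule Ck_on_subset[OF Ck_on_inverse]) auto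
  then show ?thesis unfolding Suc
    by (rule Ck_on_field_derivI[rotated 2]) (auto intro: DERIV_ln)
qed (auto intro!: continuous_intros)

lemma Ck_on_sqrt: "Ck_on k {0<..} sqrt"
proof (induction k)
  case (Suc k)
  have *: "Ck_on k {0<..} (\<lambda>x. inverse (sqrt x))"
    by (rule Ck_on_compose[OF _ Ck_on_inverse Suc]) auto
  show ?case
  proof (rule Ck_on_field_derivI)
    show "(sqrt has_field_derivative inverse (sqrt x) * (1 / 2)) (at x)" if "x \<in> {0<..}" for x
      using DERIV_real_sqrt[of x] that by simp
    show "Ck_on k {0<..} (\<lambda>x. inverse (sqrt x) * (1 / 2))"
      by (intro Ck_on_mult Ck_on_const *) auto
  qed auto
qed (auto intro!: continuous_intros)

text \<open>The derivative is again an everywhere convergent power series, with coefficients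
  \<open>diffs c\<close>; hence the induction runs over all \<open>c\<close>.\<close>

lemma Ck_on_power_series:
  fixes c :: "nat \<Rightarrow> real"
  assumes "\<And>x. summable (\<lambda>n. c n * x ^ n)"
  shows "Ck_on k UNIV (\<lambda>x. \<Sum>n. c n * x ^ n)"
  using assms
proof (induction k arbitrary: c)
  case 0
  then show ?case
    by (simp add: continuous_at_imp_continuous_on isCont_powser_converges_everywhere)
next
  case (Suc k)
  show ?case
  proof (rule Ck_on_field_derivI)
    show "((\<lambda>x. \<Sum>n. c n * x ^ n) has_field_derivative (\<Sum>n. diffs c n * x ^ n)) (at x)" for x
      by (rule termdiffs_strong_converges_everywhere[OF Suc.prems])
    show "Ck_on k UNIV (\<lambda>x. \<Sum>n. diffs c n * x ^ n)"
      by (rule Suc.IH, rule termdiff_converges_all, rule Suc.prems)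
  qed auto
qed

lemma Ck_on_vec:
  fixes f :: "'a::real_normed_vector \<Rightarrow> 'b::euclidean_space ^ 'n"
  assumes "open U" "\<And>i. Ck_on k U (\<lambda>x. f x $ i)"
  shows "Ck_on k U f"
proof -
  have "bounded_linear (axis i :: 'b \<Rightarrow> 'b^'n)" for i
    by (intro linear_conv_bounded_linear[THEN iffD1]) (simp add: linear_iff vec_eq_iff axis_def)
  then have "Ck_on k U (\<lambda>x. \<Sum>i\<in>UNIV. axis i (f x $ i))"
    using Ck_on_bounded_linear[OF assms(1) _ assms(2)] by (intro Ck_on_sum assms(1)) blast
  moreover have "(\<Sum>i\<in>UNIV. axis i (f x $ i)) = f x" for x
    by (simp add: vec_eq_iff axis_def)
  ultimately show ?thesis by simp
qed

section \<open>Divided differences of the exponential\<close>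

definition exp_quot :: "real \<Rightarrow> real" where
  "exp_quot s = (if s = 0 then 1 else (exp s - 1) / s)"

text \<open>The divided difference \<open>(exp a - exp c) / (a - c)\<close>, extended by \<open>exp a\<close> to the diagonal.\<close>

definition exp_dd :: "real \<Rightarrow> real \<Rightarrow> real" where
  "exp_dd a c = exp c * exp_quot (a - c)"

text \<open>The exponential series without its constant term, divided by \<open>s\<close>. It shows
  that the singularity at 0 is removable and gives smoothness there.\<close>

lemma exp_quot_sums: "(\<lambda>n. inverse (fact (Suc n)) * s ^ n) sums exp_quot s"
proof (cases "s = 0")
  case True
  then show ?thesis
    using powser_sums_zero[of "\<lambda>n. inverse (fact (Suc n)) :: real"] by (simp add: exp_quot_def)
next
  case False
  have "(\<lambda>n. s ^ n /\<^sub>R fact n) sums exp s" by (rule exp_converges)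
  then have "(\<lambda>n. s ^ Suc n /\<^sub>R fact (Suc n)) sums (exp s - 1)"
    by (subst sums_Suc_iff) simp
  then have "(\<lambda>n. s ^ Suc n /\<^sub>R fact (Suc n) / s) sums ((exp s - 1) / s)"
    by (rule sums_divide)
  then show ?thesis
    using False by (simp add: exp_quot_def field_simps del: fact_Suc)
qed

lemma Ck_on_exp_quot: "Ck_on k UNIV exp_quot"
proof -
  have "exp_quot = (\<lambda>s. \<Sum>n. inverse (fact (Suc n)) * s ^ n)"
    using exp_quot_sums sums_unique by blast
  then show ?thesis
    using Ck_on_power_series[of "\<lambda>n. inverse (fact (Suc n))"] exp_quot_sums sums_summable by metis
qed

lemma exp_quot_pos: "exp_quot s > 0"
  by (auto simp: exp_quot_def divide_pos_pos divide_neg_neg neq_iff)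

lemma exp_dd_pos: "exp_dd a c > 0"
  by (simp add: exp_dd_def exp_quot_pos)

lemma exp_dd_mult: "exp_dd a c * (a - c) = exp a - exp c"
  by (simp add: exp_dd_def exp_quot_def exp_diff field_simps)

text \<open>The divided difference of the \<open>k\<close>-th power at \<open>a\<close> and
  \<open>c\<close>. The recursion avoids dividing by \<open>a - c\<close> and is the one that
  off-diagonal entries of powers of an arrow matrix obey.\<close>

primrec power_dd :: "nat \<Rightarrow> real \<Rightarrow> real \<Rightarrow> real" where
  "power_dd 0 a c = 0"
| "power_dd (Suc k) a c = a ^ k + c * power_dd k a c"

lemma power_dd_mult: "power_dd k a c * (a - c) = a ^ k - c ^ k"
proof (induction k)
  case (Suc k)
  have "power_dd (Suc k) a c * (a - c) = a ^ k * (a - c) + c * (power_dd k a c * (a - c))"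
    by (simp add: algebra_simps)
  also have "\<dots> = a ^ Suc k - c ^ Suc k" unfolding Suc by (simp add: algebra_simps)
  finally show ?case .
qed simp

lemma power_dd_same: "power_dd (Suc k) a a = (1 + real k) * a ^ k"
proof (induction k)
  case (Suc k)
  have "power_dd (Suc (Suc k)) a a = a ^ Suc k + a * power_dd (Suc k) a a" by simp
  then show ?case unfolding Suc by (simp add: algebra_simps)
qed simp

lemma power_dd_sums: "(\<lambda>k. power_dd k a c /\<^sub>R fact k) sums exp_dd a c"
proof (cases "a = c")
  case True
  have "power_dd (Suc k) a a /\<^sub>R fact (Suc k) = a ^ k /\<^sub>R fact k" for k
    unfolding power_dd_same by (simp add: divide_simps)
  then have "(\<lambda>k. power_dd (Suc k) a a /\<^sub>R fact (Suc k)) sums exp a"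
    using exp_converges[of a] by (simp only:)
  \<comment> \<open>The term that the shift leaves out, at \<open>k = 0\<close>, is zero.\<close>
  then have "(\<lambda>k. power_dd k a a /\<^sub>R fact k) sums (exp a + power_dd 0 a a /\<^sub>R fact 0)"
    by (rule sums_Suc)
  then show ?thesis using True by (simp add: exp_dd_def exp_quot_def)
next
  case False
  then have *: "power_dd k a c = (a ^ k - c ^ k) / (a - c)" for k
    using power_dd_mult[of k a c] by (simp add: field_simps)
  have "exp_dd a c = (exp a - exp c) / (a - c)"
    using exp_dd_mult[of a c] False by (simp add: field_simps)
  moreover have "(\<lambda>k. (a ^ k /\<^sub>R fact k - c ^ k /\<^sub>R fact k) / (a - c)) sums ((exp a - exp c) / (a - c))"
    by (intro sums_divide sums_diff exp_converges)
  ultimately show ?thesis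
    by (simp add: * field_simps)
qed

section \<open>The matrix exponential\<close>

lemma sums_vec_iff:
  fixes f :: "nat \<Rightarrow> 'a::real_normed_vector ^ 'n"
  shows "f sums l \<longleftrightarrow> (\<forall>i. (\<lambda>k. f k $ i) sums (l $ i))"
proof
  assume "f sums l"
  then show "\<forall>i. (\<lambda>k. f k $ i) sums (l $ i)"
    by (simp add: bounded_linear.sums[OF bounded_linear_vec_nth])
next
  assume "\<forall>i. (\<lambda>k. f k $ i) sums (l $ i)"
  then show "f sums l"
    unfolding sums_def by (intro vec_tendstoI) simp
qed

abbreviation mpow :: "real^'n^'n \<Rightarrow> nat \<Rightarrow> real^'n^'n" where
  "mpow A k \<equiv> (((**) A) ^^ k) (mat 1)"

lemma mpow_mult_vec: "mpow A k *v v = (((*v) A) ^^ k) v"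
  by (induction k) (simp_all add: matrix_vector_mul_assoc[symmetric])

text \<open>A bound \<open>K\<close> for the operator \<open>A\<close> bounds every entry of the
  \<open>k\<close>-th power by \<open>K ^ k\<close>, so each entry is dominated by the series of
  \<open>exp K\<close>.\<close>

lemma matrix_exp_sums: "(\<lambda>k. mpow A k /\<^sub>R fact k) sums matrix_exp A"
proof -
  obtain K where K: "\<And>v. norm (A *v v) \<le> norm v * K" "K > 0"
    using bounded_linear.pos_bounded[OF matrix_vector_mul_bounded_linear[of A]] by blast
  have bound: "norm ((((*v) A) ^^ k) v) \<le> norm v * K ^ k" for k v
  proof (induction k)
    case (Suc k)
    have "norm ((((*v) A) ^^ Suc k) v) \<le> norm ((((*v) A) ^^ k) v) * K"
      using K(1) by simp
    also have "\<dots> \<le> (norm v * K ^ k) * K" using Suc K(2) by (simp add: mult_right_mono)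
    finally show ?case by (simp add: mult_ac)
  qed simp
  have entry: "\<bar>mpow A k $ i $ j\<bar> \<le> K ^ k" for k i j
  proof -
    have "mpow A k $ i $ j = (mpow A k *v axis j 1) $ i"
      by (simp add: matrix_vector_mult_basis column_def)
    then have "\<bar>mpow A k $ i $ j\<bar> \<le> norm (mpow A k *v axis j 1)"
      by (simp only: component_le_norm_cart)
    also have "\<dots> \<le> K ^ k" using bound[of k "axis j 1"] by (simp add: mpow_mult_vec)
    finally show ?thesis .
  qed
  have "summable (\<lambda>k. (mpow A k /\<^sub>R fact k) $ i $ j)" for i j
  proof (rule summable_comparison_test'[OF sums_summable[OF exp_converges[of K]]])
    fix k
    show "norm ((mpow A k /\<^sub>R fact k) $ i $ j) \<le> K ^ k /\<^sub>R fact k"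
      using entry[of k i j] by (simp add: abs_mult mult_left_mono)
  qed
  then have "(\<lambda>k. mpow A k /\<^sub>R fact k) sums (\<chi> i j. \<Sum>k. (mpow A k /\<^sub>R fact k) $ i $ j)"
    unfolding sums_vec_iff vec_lambda_beta using summable_sums by blast
  then show ?thesis unfolding matrix_exp_def by (rule summable_sums[OF sums_summable])
qed

lemma bounded_linear_matrix_mult_left: "bounded_linear (\<lambda>M::real^'n^'m. A ** M)"
  by (intro linear_conv_bounded_linear[THEN iffD1])
    (simp add: linear_iff matrix_add_ldistrib scalar_matrix_assoc matrix_scalar_ac)

lemma bounded_linear_matrix_mult_right: "bounded_linear (\<lambda>M::real^'n^'m. M ** A)"
  by (intro linear_conv_bounded_linear[THEN iffD1])
    (simp add: linear_iff vec_eq_iff matrix_matrix_mult_def algebra_simps sum.distrib sum_distrib_left)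

lemma matrix_exp_commute: "A ** matrix_exp A = matrix_exp A ** (A :: real^'n^'n)"
proof -
  have "A ** mpow A k = mpow A k ** A" for k
  proof (induction k)
    case (Suc k)
    have "A ** mpow A (Suc k) = A ** (A ** mpow A k)" by simp
    also have "\<dots> = mpow A (Suc k) ** A" by (subst Suc) (simp add: matrix_mul_assoc)
    finally show ?case .
  qed simp
  then have "A ** (mpow A k /\<^sub>R fact k) = (mpow A k /\<^sub>R fact k) ** A" for k
    by (simp add: matrix_scalar_ac scalar_matrix_assoc[symmetric])
  then show ?thesis
    using bounded_linear.sums[OF bounded_linear_matrix_mult_left[of A] matrix_exp_sums[of A]]
      bounded_linear.sums[OF bounded_linear_matrix_mult_right[of A] matrix_exp_sums[of A]]
    by (simp add: sums_unique2)
qed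

abbreviation cmat :: "real^'n^'m \<Rightarrow> complex^'n^'m" where
  "cmat A \<equiv> (\<chi> i j. complex_of_real (A $ i $ j))"

lemma cmat_mult: "cmat (A ** B) = cmat A ** cmat B"
  by (simp add: vec_eq_iff matrix_matrix_mult_def)

lemma cmat_mpow:
  fixes A :: "real^'n^'n"
  shows "cmat (mpow A k) *v z = (((*v) (cmat A)) ^^ k) z"
proof (induction k)
  case 0
  have "cmat (mat 1 :: real^'n^'n) = mat 1" by (simp add: vec_eq_iff mat_def)
  then show ?case by (simp only: funpow_0 matrix_vector_mul_lid)
next
  case (Suc k)
  then show ?case by (simp add: cmat_mult matrix_vector_mul_assoc[symmetric])
qed

text \<open>Eigenvectors may be complex, so the real exponential is described through its action on
  complex vectors.\<close>

lemma matrix_exp_vec_sums: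
  "(\<lambda>k. (((*v) (cmat A)) ^^ k) z /\<^sub>R fact k) sums (cmat (matrix_exp A) *v z)"
proof -
  have "(\<lambda>k. mpow A k $ i $ j /\<^sub>R fact k) sums (matrix_exp A $ i $ j)" for i j
    using matrix_exp_sums[of A] by (simp add: sums_vec_iff)
  moreover have eq: "complex_of_real (x /\<^sub>R r) * w = (complex_of_real x * w) /\<^sub>R r" for x r w
    by (simp add: scaleR_conv_of_real)
  ultimately have "(\<lambda>k. complex_of_real (mpow A k $ i $ j /\<^sub>R fact k) * z $ j)
      sums (complex_of_real (matrix_exp A $ i $ j) * z $ j)" for i j
    by (intro sums_mult2) (simp only: sums_of_real_iff)
  then have "(\<lambda>k. \<Sum>j\<in>UNIV. complex_of_real (mpow A k $ i $ j /\<^sub>R fact k) * z $ j)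
      sums (\<Sum>j\<in>UNIV. complex_of_real (matrix_exp A $ i $ j) * z $ j)" for i
    by (intro sums_sum)
  then have "(\<lambda>k. \<Sum>j\<in>UNIV. (complex_of_real (mpow A k $ i $ j) * z $ j) /\<^sub>R fact k)
      sums (\<Sum>j\<in>UNIV. complex_of_real (matrix_exp A $ i $ j) * z $ j)" for i
    by (simp only: eq)
  then show ?thesis
    by (simp add: sums_vec_iff cmat_mpow[symmetric] matrix_vector_mult_def scaleR_sum_right)
qed

section \<open>Injectivity of the exponential on matrices with real spectrum\<close>

text \<open>Split off a linear factor with root \<open>r\<close>. Either \<open>w\<close> is an
  eigenvector for \<open>r\<close>, or \<open>A *v w - r *s w\<close> is a nonzero vector of
  \<open>S\<close> annihilated by the cofactor, which has smaller degree.\<close>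

lemma eigenvector_of_annihilating_poly:
  fixes A :: "complex^'n^'n"
  assumes "vec.subspace S" "\<And>v. v \<in> S \<Longrightarrow> A *v v \<in> S"
  shows "p \<noteq> 0 \<Longrightarrow> degree p \<le> N \<Longrightarrow> w \<in> S \<Longrightarrow> w \<noteq> 0 \<Longrightarrow>
    (\<Sum>i\<le>N. poly.coeff p i *s (((*v) A) ^^ i) w) = 0 \<Longrightarrow> \<exists>\<mu> u. u \<in> S \<and> u \<noteq> 0 \<and> A *v u = \<mu> *s u"
proof (induction N arbitrary: p w)
  case 0
  then have "poly.coeff p 0 \<noteq> 0" using leading_coeff_0_iff[of p] by simp
  then show ?case using 0(4,5) by simp
next
  case (Suc N)
  show ?case
  proof (cases "degree p = 0")
    case True
    then obtain c where c: "p = [:c:]" by (rule degree_eq_zeroE)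
    then have "(\<Sum>i\<le>Suc N. poly.coeff p i *s (((*v) A) ^^ i) w) = c *s w"
      unfolding sum.atMost_Suc_shift by simp
    then show ?thesis using Suc.prems(1,4,5) c by simp
  next
    case False
    then have "\<not> constant (poly p)" by (simp add: constant_degree)
    then obtain r where "poly p r = 0" using fundamental_theorem_of_algebra by blast
    then obtain q where q: "p = [:-r, 1:] * q" unfolding poly_eq_0_iff_dvd by (rule dvdE)
    have "q \<noteq> 0" using Suc.prems(1) q by auto
    then have "degree p = Suc (degree q)" unfolding q by (subst degree_mult_eq) auto
    then have dq: "degree q \<le> N" using Suc.prems(2) by simp
    define u where "u = A *v w - r *s w"
    have pow_u: "(((*v) A) ^^ i) u = (((*v) A) ^^ Suc i) w - r *s (((*v) A) ^^ i) w" for i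
      by (induction i) (simp_all add: u_def matrix_vector_mult_diff_distrib vec.scale)
    let ?c = "poly.coeff q" and ?w = "\<lambda>i. (((*v) A) ^^ i) w"
    have "(\<Sum>i\<le>N. ?c i *s (((*v) A) ^^ i) u)
        = (\<Sum>i\<le>N. ?c i *s ?w (Suc i)) - (\<Sum>i\<le>N. (r * ?c i) *s ?w i)"
      unfolding pow_u by (simp add: vec.scale_right_diff_distrib sum_subtractf mult.commute del: funpow.simps)
    \<comment> \<open>The added top term vanishes because \<open>degree q \<le> N\<close>.\<close>
    also have "(\<Sum>i\<le>N. (r * ?c i) *s ?w i) = (\<Sum>i\<le>Suc N. (r * ?c i) *s ?w i)"
      using dq by (simp add: coeff_eq_0)
    also have "(\<Sum>i\<le>N. ?c i *s ?w (Suc i)) = (\<Sum>i\<le>Suc N. poly.coeff (pCons 0 q) i *s ?w i)"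
      by (subst sum.atMost_Suc_shift) (simp del: funpow.simps)
    also have "\<dots> - (\<Sum>i\<le>Suc N. (r * ?c i) *s ?w i) = (\<Sum>i\<le>Suc N. poly.coeff p i *s ?w i)"
      unfolding sum_subtractf[symmetric] vec.scale_left_diff_distrib[symmetric] by (simp only: q) simp
    finally have ann: "(\<Sum>i\<le>N. ?c i *s (((*v) A) ^^ i) u) = 0" using Suc.prems(5) by simp
    have "u \<in> S" unfolding u_def
      by (intro vec.subspace_diff vec.subspace_scale assms Suc.prems)
    show ?thesis
    proof (cases "u = 0")
      case True
      then have "A *v w = r *s w" by (simp add: u_def)
      then show ?thesis using Suc.prems(3,4) by blast
    next
      case False
      show ?thesis by (rule Suc.IH[OF \<open>q \<noteq> 0\<close> dq \<open>u \<in> S\<close> False ann])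
    qed
  qed
qed

text \<open>The \<open>N + 1\<close> iterates of \<open>w\<close> in dimension \<open>N\<close>
  satisfy a linear relation, whose coefficients form an annihilating polynomial.\<close>

lemma eigenvector_in_invariant_subspace:
  fixes A :: "complex^'n^'n"
  assumes "vec.subspace S" "\<And>v. v \<in> S \<Longrightarrow> A *v v \<in> S" "w \<in> S" "w \<noteq> 0"
  obtains \<mu> u where "u \<in> S" "u \<noteq> 0" "A *v u = \<mu> *s u"
proof -
  let ?w = "\<lambda>i. (((*v) A) ^^ i) w"
  define N where "N = CARD('n)"
  obtain c where c: "(\<Sum>i\<le>N. c i *s ?w i) = 0" "\<exists>i\<le>N. c i \<noteq> 0"
  \<comment> \<open>Linear dependence speaks of sets and does not see repetitions. If two iterates
    coincide, their difference is the relation.\<close>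
  proof (cases "inj_on ?w {..N}")
    case True
    have "\<not> vec.independent (?w ` {..N})"
    proof
      assume "vec.independent (?w ` {..N})"
      then have "card (?w ` {..N}) \<le> N"
        using vec.independent_bound_general[of "?w ` {..N}"] vec.dim_subset[OF subset_UNIV, of "?w ` {..N}"]
        unfolding N_def vec_dim_card by linarith
      then show False using card_image[OF True] by simp
    qed
    then obtain f where f: "(\<Sum>v\<in>?w ` {..N}. f v *s v) = 0" "\<exists>v\<in>?w ` {..N}. f v \<noteq> 0"
      using vec.dependent_finite[of "?w ` {..N}"] by auto
    show ?thesis
    proof (rule that)
      show "(\<Sum>i\<le>N. f (?w i) *s ?w i) = 0"
        using f(1) unfolding sum.reindex[OF True] o_def .
      show "\<exists>i\<le>N. f (?w i) \<noteq> 0" using f(2) by blast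
    qed
  next
    case False
    then obtain i j where ij: "i \<le> N" "j \<le> N" "i \<noteq> j" "?w i = ?w j" by (auto simp: inj_on_def)
    define c where "c k = (if k = i then 1 else 0) - (if k = j then 1 else 0 :: complex)" for k
    have "(\<Sum>k\<le>N. c k *s ?w k) = (\<Sum>k\<le>N. if k = i then ?w k else 0) - (\<Sum>k\<le>N. if k = j then ?w k else 0)"
      unfolding sum_subtractf[symmetric] c_def by (intro sum.cong) auto
    also have "\<dots> = 0" using ij by simp
    finally have "(\<Sum>k\<le>N. c k *s ?w k) = 0" .
    moreover have "c i \<noteq> 0" using ij(3) by (simp add: c_def)
    ultimately show ?thesis using that[of c] ij(1) by blast
  qed
  define p where "p = (\<Sum>i\<le>N. Polynomial.monom (c i) i)"
  have cp: "poly.coeff p i = (if i \<le> N then c i else 0)" for i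
    by (simp add: p_def coeff_sum)
  obtain i where "i \<le> N" "c i \<noteq> 0" using c(2) by blast
  then have "poly.coeff p i \<noteq> 0" by (simp add: cp)
  then have "p \<noteq> 0" by auto
  moreover have "degree p \<le> N" by (rule degree_le) (simp add: cp)
  moreover have "(\<Sum>i\<le>N. poly.coeff p i *s ?w i) = 0" using c(1) by (simp add: cp)
  ultimately have "\<exists>\<mu> u. u \<in> S \<and> u \<noteq> 0 \<and> A *v u = \<mu> *s u"
    by (intro eigenvector_of_annihilating_poly[OF assms(1,2) _ _ assms(3,4)])
  then show ?thesis using that by blast
qed

text \<open>The range of \<open>Z\<close> is invariant under \<open>X\<close> and \<open>Y\<close>,
  and an eigenspace of \<open>X\<close> inside it is invariant under \<open>Y\<close>. The preimage
  \<open>z\<close> is kept because the difference of the exponentials will be applied to it.\<close>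

lemma common_eigenvector_in_range:
  fixes X Y Z :: "complex^'n^'n"
  assumes "X ** Y = Y ** X" "X ** Z = Z ** X" "Y ** Z = Z ** Y" "Z \<noteq> 0"
  obtains \<mu> \<nu> z where "Z *v z \<noteq> 0" "X *v (Z *v z) = \<mu> *s (Z *v z)" "Y *v (Z *v z) = \<nu> *s (Z *v z)"
proof -
  let ?R = "range ((*v) Z)"
  have commute_vec: "A *v (B *v v) = B *v (A *v v)" if "A ** B = B ** A" for A B :: "complex^'n^'n" and v
    by (simp only: matrix_vector_mul_assoc that)
  have inv: "A *v v \<in> ?R" if "A ** Z = Z ** A" "v \<in> ?R" for A v
    using that(2) commute_vec[OF that(1)] by fastforce
  have R: "vec.subspace ?R"
    by (rule vec.linear_subspace_image[OF matrix_vector_mul_linear_gen vec.subspace_UNIV])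
  obtain w where "Z *v w \<noteq> 0"
    using assms(4) matrix_eq[of Z 0] by auto
  then obtain \<mu> u where u: "u \<in> ?R" "u \<noteq> 0" "X *v u = \<mu> *s u"
    using eigenvector_in_invariant_subspace[OF R inv[OF assms(2)], of "Z *v w"] by blast
  define E where "E = {v \<in> ?R. X *v v = \<mu> *s v}"
  have E: "vec.subspace E"
  proof (rule vec.subspaceI)
    show "0 \<in> E" using vec.subspace_0[OF R] by (simp add: E_def)
    show "v + w \<in> E" if "v \<in> E" "w \<in> E" for v w
      using that vec.subspace_add[OF R] unfolding E_def
      by (simp add: matrix_vector_right_distrib vec.scale_right_distrib)
    show "c *s v \<in> E" if "v \<in> E" for c v
      using that vec.subspace_scale[OF R] unfolding E_def
      by (simp add: vec.scale mult.commute)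
  qed
  have "Y *v v \<in> E" if "v \<in> E" for v
  proof -
    have "X *v (Y *v v) = Y *v (X *v v)" by (rule commute_vec[OF assms(1)])
    then show ?thesis using that inv[OF assms(3)] by (simp add: E_def vec.scale)
  qed
  then obtain \<nu> v where v: "v \<in> E" "v \<noteq> 0" "Y *v v = \<nu> *s v"
    using eigenvector_in_invariant_subspace[OF E, of Y u] u unfolding E_def by blast
  then obtain z where "v = Z *v z" "X *v v = \<mu> *s v" unfolding E_def by blast
  then show ?thesis using v that by blast
qed

lemma funpow_eigenvector:
  fixes A :: "complex^'n^'n"
  assumes "A *v u = \<mu> *s u"
  shows "(((*v) A) ^^ k) u = \<mu> ^ k *s u"
  by (induction k) (simp_all add: vec.scale assms mult.commute)

lemma matrix_exp_eigenvector:
  assumes "cmat A *v u = \<mu> *s u"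
  shows "cmat (matrix_exp A) *v u = exp \<mu> *s u"
proof -
  have "(\<lambda>k. (\<mu> ^ k /\<^sub>R fact k) * u $ i) sums (exp \<mu> * u $ i)" for i
    by (intro sums_mult2 exp_converges)
  then have "(\<lambda>k. (\<mu> ^ k *s u) /\<^sub>R fact k) sums (exp \<mu> *s u)"
    by (simp add: sums_vec_iff)
  then show ?thesis
    using matrix_exp_vec_sums[of A u] unfolding funpow_eigenvector[OF assms] by (rule sums_unique2[symmetric])
qed

definition real_spectrum :: "real^'n^'n \<Rightarrow> bool" where
  "real_spectrum A \<longleftrightarrow> (\<forall>\<mu>. complex_eigenvalue A \<mu> \<longrightarrow> Im \<mu> = 0)"

text \<open>If \<open>Z = X - Y\<close> is nonzero, its range contains a common eigenvector \<open>u = Z z\<close> of \<open>X\<close> and \<open>Y\<close>, and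
  \<open>(exp X - exp Y) z\<close> is a positive multiple of \<open>u\<close>, the factor being a divided difference of \<open>exp\<close>.\<close>

lemma matrix_exp_inj_real_spectrum:
  fixes X Y :: "real^'n^'n"
  assumes comm: "X ** Y = Y ** X" and eq: "matrix_exp X = matrix_exp Y"
    and real: "real_spectrum X" "real_spectrum Y"
  shows "X = Y"
proof (rule ccontr)
  assume "X \<noteq> Y"
  let ?X = "cmat X" and ?Y = "cmat Y"
  define Z where "Z = ?X - ?Y"
  have "Z \<noteq> 0" using \<open>X \<noteq> Y\<close> by (auto simp: Z_def vec_eq_iff)
  have XY: "?X ** ?Y = ?Y ** ?X" using comm by (metis cmat_mult)
  have diffs: "A ** (B - C) = A ** B - A ** C" "(B - C) ** A = B ** A - C ** A" for A B C :: "complex^'n^'n"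
    by (simp_all add: vec_eq_iff matrix_matrix_mult_def algebra_simps sum_subtractf)
  have "?X ** Z = Z ** ?X" "?Y ** Z = Z ** ?Y" by (simp_all add: Z_def diffs XY)
  from common_eigenvector_in_range[OF XY this \<open>Z \<noteq> 0\<close>]
  obtain \<mu> \<nu> z where z: "Z *v z \<noteq> 0" "?X *v (Z *v z) = \<mu> *s (Z *v z)" "?Y *v (Z *v z) = \<nu> *s (Z *v z)" .
  define u where "u = Z *v z"
  have u: "u \<noteq> 0" "?X *v u = \<mu> *s u" "?Y *v u = \<nu> *s u" using z by (simp_all add: u_def)
  \<comment> \<open>Reality matters here: the divided difference of \<open>exp\<close> vanishes at
    complex numbers that differ by a nonzero multiple of \<open>2 * pi * \<i>\<close>.\<close>
  have "Im \<mu> = 0" "Im \<nu> = 0" using real u unfolding real_spectrum_def complex_eigenvalue_def by blast+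
  then obtain m n where mn: "\<mu> = complex_of_real m" "\<nu> = complex_of_real n"
    by (metis complex_is_Real_iff Reals_cases)
  have ZY: "Z *v (((*v) ?Y) ^^ k) z = (((*v) ?Y) ^^ k) u" for k
  proof (induction k)
    case (Suc k)
    have "Z *v (?Y *v w) = ?Y *v (Z *v w)" for w
      by (simp add: matrix_vector_mul_assoc \<open>?Y ** Z = Z ** ?Y\<close>)
    with Suc show ?case by simp
  qed (simp add: u_def)
  \<comment> \<open>Telescoping: the difference of the powers of order \<open>k + 1\<close> is
    \<open>?X\<close> applied to the difference of order \<open>k\<close>, plus \<open>Z\<close>
    applied to the \<open>k\<close>-th iterate under \<open>?Y\<close>. On multiples of
    \<open>u\<close> these two terms reproduce the recursion of \<open>power_dd\<close>.\<close>
  have power: "(((*v) ?X) ^^ k) z - (((*v) ?Y) ^^ k) z = complex_of_real (power_dd k n m) *s u" for k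
  proof (induction k)
    case (Suc k)
    have "(((*v) ?X) ^^ Suc k) z - (((*v) ?Y) ^^ Suc k) z
        = ?X *v ((((*v) ?X) ^^ k) z - (((*v) ?Y) ^^ k) z) + Z *v (((*v) ?Y) ^^ k) z"
      by (simp add: Z_def matrix_vector_mult_diff_rdistrib matrix_vector_mult_diff_distrib)
    also have "\<dots> = complex_of_real (power_dd (Suc k) n m) *s u"
      unfolding Suc ZY funpow_eigenvector[OF u(3)]
      by (simp add: vec.scale u mn vec.scale_left_distrib mult.commute add.commute)
    finally show ?case .
  qed simp
  have "(\<lambda>k. ((((*v) ?X) ^^ k) z /\<^sub>R fact k - (((*v) ?Y) ^^ k) z /\<^sub>R fact k))
      sums (cmat (matrix_exp X) *v z - cmat (matrix_exp Y) *v z)"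
    by (intro sums_diff matrix_exp_vec_sums)
  then have "(\<lambda>k. (complex_of_real (power_dd k n m) *s u) /\<^sub>R fact k) sums 0"
    by (simp add: eq scaleR_diff_right[symmetric] power)
  then have "(\<lambda>k. (complex_of_real (power_dd k n m) * u $ i) /\<^sub>R fact k) sums 0" for i
    by (simp add: sums_vec_iff)
  then have "(\<lambda>k. complex_of_real (power_dd k n m /\<^sub>R fact k) * u $ i) sums 0" for i
    by (simp add: scaleR_conv_of_real mult.assoc)
  moreover have "(\<lambda>k. complex_of_real (power_dd k n m /\<^sub>R fact k) * u $ i)
      sums (complex_of_real (exp_dd n m) * u $ i)" for i
    by (intro sums_mult2) (simp only: sums_of_real_iff power_dd_sums)
  ultimately have "complex_of_real (exp_dd n m) * u $ i = 0" for i
    using sums_unique2 by blast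
  then have "u = 0" using exp_dd_pos[of n m] by (simp add: vec_eq_iff)
  with u(1) show False ..
qed

text \<open>In the open strip an eigenvalue is the principal logarithm of its exponential, which is
  a positive real number.\<close>

lemma real_spectrum_of_exp_positive:
  assumes "\<And>\<mu>. complex_eigenvalue X \<mu> \<Longrightarrow> - pi < Im \<mu> \<and> Im \<mu> < pi"
    and "\<And>\<mu>. complex_eigenvalue (matrix_exp X) \<mu> \<Longrightarrow> \<exists>r>0. \<mu> = complex_of_real r"
  shows "real_spectrum X"
  unfolding real_spectrum_def
proof (intro allI impI)
  fix \<mu> assume ev: "complex_eigenvalue X \<mu>"
  then have "complex_eigenvalue (matrix_exp X) (exp \<mu>)"
    unfolding complex_eigenvalue_def using matrix_exp_eigenvector by blast
  then obtain r where "r > 0" "exp \<mu> = complex_of_real r" using assms(2) by blast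
  moreover have "\<mu> = Ln (exp \<mu>)" using assms(1)[OF ev] by simp
  ultimately show "Im \<mu> = 0" by (simp add: Ln_of_real)
qed

section \<open>Arrow matrices\<close>

definition arrow :: "real \<Rightarrow> real \<Rightarrow> real \<Rightarrow> real \<Rightarrow> real \<Rightarrow> real^3^3" where
  "arrow a b c d e = vector [vector [a, 0, 0], vector [0, b, 0], vector [d, e, c]]"

definition sym_arrow :: "real \<Rightarrow> real \<Rightarrow> real \<Rightarrow> real \<Rightarrow> real \<Rightarrow> real^3^3" where
  "sym_arrow a b c d e = vector [vector [a, 0, d], vector [0, b, e], vector [d, e, c]]"

lemma arrow_nth [simp]:
  "arrow a b c d e $ 1 = vector [a, 0, 0]"
  "arrow a b c d e $ 2 = vector [0, b, 0]"
  "arrow a b c d e $ 3 = vector [d, e, c]"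
  by (simp_all add: arrow_def)

lemma sym_arrow_nth [simp]:
  "sym_arrow a b c d e $ 1 = vector [a, 0, d]"
  "sym_arrow a b c d e $ 2 = vector [0, b, e]"
  "sym_arrow a b c d e $ 3 = vector [d, e, c]"
  by (simp_all add: sym_arrow_def)

lemma mat3_eq_iff: "A = B \<longleftrightarrow>
    A $ 1 $ 1 = B $ 1 $ 1 \<and> A $ 1 $ 2 = B $ 1 $ 2 \<and> A $ 1 $ 3 = B $ 1 $ 3 \<and>
    A $ 2 $ 1 = B $ 2 $ 1 \<and> A $ 2 $ 2 = B $ 2 $ 2 \<and> A $ 2 $ 3 = B $ 2 $ 3 \<and>
    A $ 3 $ 1 = B $ 3 $ 1 \<and> A $ 3 $ 2 = B $ 3 $ 2 \<and> A $ 3 $ 3 = B $ 3 $ (3::3)"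
  for A B :: "'a^3^3"
  unfolding vec_eq_iff forall_3 by blast

text \<open>Each off-diagonal entry interacts with one pair of diagonal entries only, as in two
  triangular 2x2 blocks sharing the corner \<open>c\<close>. Hence the exponential involves first
  divided differences only.\<close>

lemma arrow_mult: "arrow a b c d e ** arrow a' b' c' d' e' =
    arrow (a * a') (b * b') (c * c') (d * a' + c * d') (e * b' + c * e')"
  by (simp add: mat3_eq_iff matrix_matrix_mult_def sum_3)

lemma arrow_gram: "arrow a b c d e ** transpose (arrow a b c d e) =
    sym_arrow (a * a) (b * b) (d * d + e * e + c * c) (d * a) (e * b)"
  by (simp add: mat3_eq_iff matrix_matrix_mult_def transpose_def sum_3)

lemma arrow_plus_transpose:
  "arrow a b c d e + transpose (arrow a b c d e) = sym_arrow (2 * a) (2 * b) (2 * c) d e"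
  by (simp add: mat3_eq_iff transpose_def)

lemma arrow_one: "mat 1 = arrow 1 1 1 0 0"
  by (simp add: mat3_eq_iff mat_def)

lemma sym_arrow_one: "mat 1 = sym_arrow 1 1 1 0 0"
  by (simp add: mat3_eq_iff mat_def)

lemma mpow_arrow: "mpow (arrow a b c d e) k =
    arrow (a ^ k) (b ^ k) (c ^ k) (d * power_dd k a c) (e * power_dd k b c)"
  by (induction k) (simp_all add: arrow_one arrow_mult algebra_simps)

lemma matrix_exp_arrow: "matrix_exp (arrow a b c d e) =
    arrow (exp a) (exp b) (exp c) (d * exp_dd a c) (e * exp_dd b c)"
proof -
  have dd: "(\<lambda>k. (w * power_dd k x y) /\<^sub>R fact k) sums (w * exp_dd x y)" for w x y
    using sums_mult[OF power_dd_sums[of x y], of w] by (simp add: mult_ac)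
  have "(\<lambda>k. mpow (arrow a b c d e) k /\<^sub>R fact k) sums
      arrow (exp a) (exp b) (exp c) (d * exp_dd a c) (e * exp_dd b c)"
    unfolding sums_vec_iff mpow_arrow forall_3
    using exp_converges[of a] exp_converges[of b] exp_converges[of c] dd[of d a c] dd[of e b c] by simp
  then show ?thesis using sums_unique2 matrix_exp_sums by blast
qed

lemma complex_eigenvalue_arrow:
  assumes "complex_eigenvalue (arrow a b c d e) \<mu>"
  shows "\<mu> = complex_of_real a \<or> \<mu> = complex_of_real b \<or> \<mu> = complex_of_real c"
proof -
  obtain z where "z \<noteq> 0" "cmat (arrow a b c d e) *v z = \<mu> *s z"
    using assms unfolding complex_eigenvalue_def by blast
  then have "complex_of_real a * z $ 1 = \<mu> * z $ 1" "complex_of_real b * z $ 2 = \<mu> * z $ 2"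
    "complex_of_real d * z $ 1 + complex_of_real e * z $ 2 + complex_of_real c * z $ 3 = \<mu> * z $ 3"
    "z $ 1 \<noteq> 0 \<or> z $ 2 \<noteq> 0 \<or> z $ 3 \<noteq> 0"
    by (simp_all add: vec_eq_iff forall_3 matrix_vector_mult_def sum_3)
  then show ?thesis by auto
qed

text \<open>An arrow matrix is a quadratic polynomial in its exponential, which interpolates \<open>ln\<close> at \<open>exp c\<close>, \<open>exp a\<close>, \<open>exp b\<close> in
  Newton form, with \<open>r\<close> the second divided difference.\<close>

lemma arrow_commute_exp:
  assumes "X ** matrix_exp (arrow a b c d e) = matrix_exp (arrow a b c d e) ** X"
  shows "X ** arrow a b c d e = arrow a b c d e ** X"
proof -
  define T where "T = matrix_exp (arrow a b c d e)"
  define f g where "f = exp_dd a c" and "g = exp_dd b c"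
  have pos: "f > 0" "g > 0" by (simp_all add: f_def g_def exp_dd_pos)
  have fa: "exp a = exp c + f * (a - c)" and gb: "exp b = exp c + g * (b - c)"
    unfolding f_def g_def exp_dd_mult by simp_all
  \<comment> \<open>\<open>1 / f\<close> and \<open>1 / g\<close> are first divided differences of
    \<open>ln\<close>. If \<open>a = b\<close> they agree and any \<open>r\<close> satisfies the
    next equation.\<close>
  define r where "r = (if a = b then 0 else (1 / g - 1 / f) / (exp b - exp a))"
  have r: "1 / f + r * (exp b - exp a) = 1 / g"
    by (auto simp: r_def f_def g_def)
  \<comment> \<open>The linear coefficient of the Newton form expanded in powers of
    \<open>x\<close>.\<close>
  define s where "s = 1 / f - r * (exp a + exp c)"
  have "arrow a b c d e = (c - exp c / f + r * exp a * exp c) *\<^sub>R mat 1 + s *\<^sub>R T + r *\<^sub>R (T ** T)"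
  proof -
    have T: "T = arrow (exp a) (exp b) (exp c) (d * f) (e * g)"
      by (simp add: T_def f_def g_def matrix_exp_arrow)
    have newton: "c - exp c / f + r * exp a * exp c + s * x + r * (x * x)
        = c + (x - exp c) * (1 / f + r * (x - exp a))" for x
      by (simp add: s_def algebra_simps diff_divide_distrib)
    \<comment> \<open>The factor by which the polynomial multiplies an off-diagonal entry of
      \<open>T\<close>; at \<open>exp a\<close> and \<open>exp b\<close> it must cancel
      \<open>f\<close> and \<open>g\<close>.\<close>
    have lin: "s + r * (x + exp c) = 1 / f + r * (x - exp a)" for x
      by (simp add: s_def algebra_simps)
    have "a = c + (exp a - exp c) * (1 / f + r * (exp a - exp a))"
      using pos fa by simp
    moreover have "b = c + (exp b - exp c) * (1 / f + r * (exp b - exp a))"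
      unfolding r using pos gb by simp
    moreover have "c = c + (exp c - exp c) * (1 / f + r * (exp c - exp a))" by simp
    moreover have "d = d * f * (s + r * (exp a + exp c))"
      unfolding lin using pos by simp
    moreover have "e = e * g * (s + r * (exp b + exp c))"
      unfolding lin r using pos by simp
    ultimately show ?thesis
      unfolding T arrow_mult unfolding arrow_one newton[symmetric]
      by (simp add: mat3_eq_iff algebra_simps)
  qed
  moreover have "X ** (T ** T) = (T ** T) ** X"
    using assms by (metis T_def matrix_mul_assoc)
  moreover have "X ** T = T ** X" using assms by (simp add: T_def)
  ultimately show ?thesis
    by (simp add: matrix_add_ldistrib matrix_scalar_ac linear_add[OF bounded_linear.linear[OF bounded_linear_matrix_mult_right]]
        scalar_matrix_assoc[symmetric])
qed

text \<open>For a competing logarithm, \<open>matrix_exp X\<close> is an arrow matrix with positive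
  diagonal, so its eigenvalues are positive and those of \<open>X\<close> are real.\<close>

lemma matrix_log_exp_arrow: "matrix_log (matrix_exp (arrow a b c d e)) = arrow a b c d e"
  unfolding matrix_log_def
proof (rule the_equality)
  have real: "Im \<mu> = 0" if "complex_eigenvalue (arrow a b c d e) \<mu>" for \<mu>
    using complex_eigenvalue_arrow[OF that] by auto
  then show "matrix_exp (arrow a b c d e) = matrix_exp (arrow a b c d e) \<and>
      (\<forall>\<mu>. complex_eigenvalue (arrow a b c d e) \<mu> \<longrightarrow> - pi < Im \<mu> \<and> Im \<mu> < pi)"
    by simp
  fix X
  assume X: "matrix_exp X = matrix_exp (arrow a b c d e) \<and>
    (\<forall>\<mu>. complex_eigenvalue X \<mu> \<longrightarrow> - pi < Im \<mu> \<and> Im \<mu> < pi)"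
  show "X = arrow a b c d e"
  proof (rule matrix_exp_inj_real_spectrum)
    show "X ** arrow a b c d e = arrow a b c d e ** X"
      using matrix_exp_commute[of X] X by (intro arrow_commute_exp) simp
    show "matrix_exp X = matrix_exp (arrow a b c d e)" using X by blast
    show "real_spectrum X"
    proof (rule real_spectrum_of_exp_positive)
      show "- pi < Im \<mu> \<and> Im \<mu> < pi" if "complex_eigenvalue X \<mu>" for \<mu> using X that by blast
      show "\<exists>r>0. \<mu> = complex_of_real r" if "complex_eigenvalue (matrix_exp X) \<mu>" for \<mu>
      proof -
        have "complex_eigenvalue (arrow (exp a) (exp b) (exp c) (d * exp_dd a c) (e * exp_dd b c)) \<mu>"
          using that X by (simp add: matrix_exp_arrow)
        from complex_eigenvalue_arrow[OF this] show ?thesis using exp_gt_zero by blast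
      qed
    qed
    show "real_spectrum (arrow a b c d e)" using real by (simp add: real_spectrum_def)
  qed
qed

section \<open>Coordinates on the clan\<close>

lemma clan_space_iff: "v \<in> clan_space \<longleftrightarrow>
    v = sym_arrow (v $ 1 $ 1) (v $ 2 $ 2) (v $ 3 $ 3) (v $ 3 $ 1) (v $ 3 $ 2)"
  by (auto simp: clan_space_def mat3_eq_iff transpose_def)

lemma sym_arrow_in_clan_space: "sym_arrow a b c d e \<in> clan_space"
  by (simp add: clan_space_iff)

text \<open>The diagonal is halved so that the parameters are exactly those of the lower triangular
  part.\<close>

lemma clan_space_cases:
  assumes "v \<in> clan_space"
  obtains a b c d e where "v = sym_arrow (2 * a) (2 * b) (2 * c) d e"
  using assms[unfolded clan_space_iff] that[of "v $ 1 $ 1 / 2" "v $ 2 $ 2 / 2" "v $ 3 $ 3 / 2"] by simp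

lemma subspace_clan_space: "subspace clan_space"
  by (auto simp: subspace_def clan_space_def transpose_def vec_eq_iff)

lemma lower_part_sym_arrow: "lower_part (sym_arrow (2 * a) (2 * b) (2 * c) d e) = arrow a b c d e"
  unfolding lower_part_def
  by (rule the_equality) (auto simp: lower_triangular_def arrow_plus_transpose mat3_eq_iff transpose_def)

text \<open>The entries of a competing factor \<open>T\<close> are solved for row by row. It is only
  known to be lower triangular; the zero (2,1) entry of the product forces
  \<open>T $ 2 $ 1 = 0\<close>.\<close>

lemma cholesky_arrow_gram:
  assumes "a > 0" "b > 0" "c > 0"
  shows "cholesky (arrow a b c d e ** transpose (arrow a b c d e)) = arrow a b c d e"
  unfolding cholesky_def
proof (rule the_equality)
  show "lower_triangular (arrow a b c d e) \<and> (\<forall>i. 0 < arrow a b c d e $ i $ i) \<and>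
    arrow a b c d e ** transpose (arrow a b c d e) = arrow a b c d e ** transpose (arrow a b c d e)"
    using assms by (simp add: lower_triangular_def forall_3)
  fix T
  assume "lower_triangular T \<and> (\<forall>i. 0 < T $ i $ i) \<and>
    arrow a b c d e ** transpose (arrow a b c d e) = T ** transpose T"
  then have upper: "T $ 1 $ 2 = 0" "T $ 1 $ 3 = 0" "T $ 2 $ 3 = 0"
    and pos: "T $ 1 $ 1 > 0" "T $ 2 $ 2 > 0" "T $ 3 $ 3 > 0"
    and eq: "sym_arrow (a * a) (b * b) (d * d + e * e + c * c) (d * a) (e * b) = T ** transpose T"
    by (simp_all add: lower_triangular_def arrow_gram)
  have e11: "a * a = T $ 1 $ 1 * T $ 1 $ 1" and e21: "0 = T $ 2 $ 1 * T $ 1 $ 1"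
    and e22: "b * b = T $ 2 $ 1 * T $ 2 $ 1 + T $ 2 $ 2 * T $ 2 $ 2"
    and e31: "d * a = T $ 3 $ 1 * T $ 1 $ 1"
    and e32: "e * b = T $ 3 $ 1 * T $ 2 $ 1 + T $ 3 $ 2 * T $ 2 $ 2"
    and e33: "d * d + e * e + c * c = T $ 3 $ 1 * T $ 3 $ 1 + T $ 3 $ 2 * T $ 3 $ 2 + T $ 3 $ 3 * T $ 3 $ 3"
    using eq upper by (simp_all add: mat3_eq_iff matrix_matrix_mult_def transpose_def sum_3)
  have sq: "x = y" if "x * x = y * y" "x > 0" "y > 0" for x y :: real
    using that by (metis abs_of_pos abs_mult_self_eq real_sqrt_abs2)
  have t11: "T $ 1 $ 1 = a" using sq[OF e11] assms pos by simp
  have t21: "T $ 2 $ 1 = 0" using e21 pos by simp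
  have t22: "T $ 2 $ 2 = b" using sq[of b "T $ 2 $ 2"] e22 t21 assms pos by simp
  have t31: "T $ 3 $ 1 = d" using e31 t11 assms by simp
  have t32: "T $ 3 $ 2 = e" using e32 t21 t22 assms by simp
  have t33: "T $ 3 $ 3 = c" using sq[of c "T $ 3 $ 3"] e33 t31 t32 assms pos by simp
  show "T = arrow a b c d e" by (simp add: mat3_eq_iff upper t11 t21 t22 t31 t32 t33)
qed

text \<open>The Schur complement of the upper left diagonal block; on the cone it is the square of
  the last Cholesky pivot.\<close>

definition schur :: "real^3^3 \<Rightarrow> real" where
  "schur x = x $ 3 $ 3 - (x $ 3 $ 1)\<^sup>2 * inverse (x $ 1 $ 1) - (x $ 3 $ 2)\<^sup>2 * inverse (x $ 2 $ 2)"

text \<open>No symmetry is imposed, which makes this an open set of matrices.\<close>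

definition schur_domain :: "(real^3^3) set" where
  "schur_domain = {x. 0 < x $ 1 $ 1 \<and> 0 < x $ 2 $ 2 \<and> 0 < schur x}"

lemma clan_cone_eq: "clan_cone = clan_space \<inter> schur_domain"
proof (intro equalityI subsetI)
  fix x assume x: "x \<in> clan_space \<inter> schur_domain"
  have sym: "x = sym_arrow (x $ 1 $ 1) (x $ 2 $ 2) (x $ 3 $ 3) (x $ 3 $ 1) (x $ 3 $ 2)"
    using x by (simp add: clan_space_iff)
  have pos: "x $ 1 $ 1 > 0" "x $ 2 $ 2 > 0" "schur x > 0" using x by (auto simp: schur_domain_def)
  have "0 < z \<bullet> (x *v z)" if "z \<noteq> 0" for z
  proof -
    \<comment> \<open>Completing the square in the first two coordinates.\<close>
    define u v where "u = z $ 1 + x $ 3 $ 1 * z $ 3 / x $ 1 $ 1" and "v = z $ 2 + x $ 3 $ 2 * z $ 3 / x $ 2 $ 2"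
    have "z \<bullet> (x *v z) = x $ 1 $ 1 * u\<^sup>2 + x $ 2 $ 2 * v\<^sup>2 + schur x * (z $ 3)\<^sup>2"
      by (subst sym) (use pos in \<open>simp add: inner_vec_def matrix_vector_mult_def sum_3 u_def v_def schur_def
          power2_eq_square field_simps\<close>)
    moreover have "u \<noteq> 0 \<or> v \<noteq> 0 \<or> z $ 3 \<noteq> 0"
      using that by (auto simp: u_def v_def vec_eq_iff forall_3)
    ultimately show ?thesis using pos
      by (smt (verit) mult_nonneg_nonneg mult_pos_pos zero_le_power2 zero_less_power2)
  qed
  then show "x \<in> clan_cone" using x by (simp add: clan_cone_def)
next
  fix x assume "x \<in> clan_cone"
  then have V: "x \<in> clan_space" and pd: "\<And>z. z \<noteq> 0 \<Longrightarrow> 0 < z \<bullet> (x *v z)" by (auto simp: clan_cone_def)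
  have sym: "x $ 1 $ 2 = 0" "x $ 2 $ 1 = 0" "x $ 1 $ 3 = x $ 3 $ 1" "x $ 2 $ 3 = x $ 3 $ 2"
    using V by (auto simp: clan_space_iff mat3_eq_iff)
  have quad: "vector [p, q, r] \<bullet> (x *v vector [p, q, r]) = x $ 1 $ 1 * p\<^sup>2 + x $ 2 $ 2 * q\<^sup>2 + x $ 3 $ 3 * r\<^sup>2
      + 2 * x $ 3 $ 1 * p * r + 2 * x $ 3 $ 2 * q * r" for p q r
    by (simp add: inner_vec_def matrix_vector_mult_def sum_3 sym power2_eq_square algebra_simps)
  have nz: "vector [p, q, r] \<noteq> (0 :: real^3)" if "p \<noteq> 0 \<or> q \<noteq> 0 \<or> r \<noteq> 0" for p q r
    using that by (auto simp: vec_eq_iff forall_3)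
  have p1: "x $ 1 $ 1 > 0" using pd[OF nz[of 1 0 0]] by (simp add: quad)
  have p2: "x $ 2 $ 2 > 0" using pd[OF nz[of 0 1 0]] by (simp add: quad)
  \<comment> \<open>The minimiser of the quadratic form among vectors with last coordinate
    1.\<close>
  let ?z = "vector [- x $ 3 $ 1 / x $ 1 $ 1, - x $ 3 $ 2 / x $ 2 $ 2, 1] :: real^3"
  have "?z \<bullet> (x *v ?z) = schur x"
    unfolding quad using p1 p2 by (simp add: schur_def power2_eq_square field_simps)
  moreover have "?z \<noteq> 0" by (rule nz) simp
  ultimately have "0 < schur x" using pd by metis
  then show "x \<in> clan_space \<inter> schur_domain" using V p1 p2 by (simp add: schur_domain_def)
qed

text \<open>Smooth extensions of \<open>clan_Exp\<close> and \<open>clan_Log\<close> from \<open>clan_space\<close> and the cone to open sets of matrices.\<close>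

definition exp_coords :: "real^3^3 \<Rightarrow> real^3^3" where
  "exp_coords v = (let a = v $ 1 $ 1 * (1 / 2); b = v $ 2 $ 2 * (1 / 2); c = v $ 3 $ 3 * (1 / 2);
      d = v $ 3 $ 1 * exp_dd a c; e = v $ 3 $ 2 * exp_dd b c in
    sym_arrow (exp a * exp a) (exp b * exp b) (d * d + e * e + exp c * exp c) (d * exp a) (e * exp b))"

text \<open>Here \<open>p\<close>, \<open>q\<close>, \<open>r\<close> are the Cholesky pivots.
  Multiplying by \<open>inverse p\<close> or \<open>inverse q\<close> gives the last row of the
  Cholesky factor, and the inverse of \<open>exp_dd\<close> undoes the exponential there.\<close>

definition log_coords :: "real^3^3 \<Rightarrow> real^3^3" where
  "log_coords x = (let p = sqrt (x $ 1 $ 1); q = sqrt (x $ 2 $ 2); r = sqrt (schur x) in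
    sym_arrow (2 * ln p) (2 * ln q) (2 * ln r)
      (x $ 3 $ 1 * inverse p * inverse (exp_dd (ln p) (ln r)))
      (x $ 3 $ 2 * inverse q * inverse (exp_dd (ln q) (ln r))))"

lemma clan_Exp_sym_arrow: "clan_Exp (sym_arrow (2 * a) (2 * b) (2 * c) d e) =
    matrix_exp (arrow a b c d e) ** transpose (matrix_exp (arrow a b c d e))"
  by (simp add: clan_Exp_def lower_part_sym_arrow)

lemma clan_Exp_eq_coords:
  assumes "v \<in> clan_space"
  shows "clan_Exp v = exp_coords v"
  by (rule clan_space_cases[OF assms])
    (simp add: clan_Exp_sym_arrow matrix_exp_arrow arrow_gram exp_coords_def Let_def)

lemma schur_gram:
  assumes "a \<noteq> 0" "b \<noteq> 0"
  shows "schur (sym_arrow (a * a) (b * b) (d * d + e * e + c * c) (d * a) (e * b)) = c * c"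
  using assms by (simp add: schur_def power2_eq_square field_simps)

lemma exp_coords_in_schur_domain: "exp_coords v \<in> schur_domain"
  by (simp add: schur_domain_def exp_coords_def Let_def schur_gram)

lemma clan_Exp_in_cone: "v \<in> clan_space \<Longrightarrow> clan_Exp v \<in> clan_cone"
  unfolding clan_cone_eq using exp_coords_in_schur_domain
  by (simp add: clan_Exp_eq_coords) (simp add: exp_coords_def Let_def sym_arrow_in_clan_space)

lemma clan_Log_Exp:
  assumes "v \<in> clan_space"
  shows "clan_Log (clan_Exp v) = v"
proof (rule clan_space_cases[OF assms])
  fix a b c d e assume v: "v = sym_arrow (2 * a) (2 * b) (2 * c) d e"
  have "cholesky (clan_Exp v) = matrix_exp (arrow a b c d e)"
    unfolding v clan_Exp_sym_arrow unfolding matrix_exp_arrow by (rule cholesky_arrow_gram) simp_all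
  then show "clan_Log (clan_Exp v) = v"
    by (simp add: clan_Log_def matrix_log_exp_arrow arrow_plus_transpose v)
qed

lemma clan_Exp_log_coords:
  assumes "x \<in> clan_cone"
  shows "clan_Exp (log_coords x) = x"
proof -
  define p q r where "p = sqrt (x $ 1 $ 1)" and "q = sqrt (x $ 2 $ 2)" and "r = sqrt (schur x)"
  have x: "x \<in> clan_space" "x \<in> schur_domain" using assms by (auto simp: clan_cone_eq)
  then have pos: "p > 0" "q > 0" "r > 0" and sq: "p * p = x $ 1 $ 1" "q * q = x $ 2 $ 2" "r * r = schur x"
    by (auto simp: schur_domain_def p_def q_def r_def)
  have dd: "exp_dd s t \<noteq> 0" for s t using exp_dd_pos[of s t] by simp
  have L: "log_coords x = sym_arrow (2 * ln p) (2 * ln q) (2 * ln r)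
      (x $ 3 $ 1 / p / exp_dd (ln p) (ln r)) (x $ 3 $ 2 / q / exp_dd (ln q) (ln r))"
    by (simp add: log_coords_def Let_def p_def q_def r_def divide_inverse)
  have "clan_Exp (log_coords x) = arrow p q r (x $ 3 $ 1 / p) (x $ 3 $ 2 / q)
      ** transpose (arrow p q r (x $ 3 $ 1 / p) (x $ 3 $ 2 / q))"
    unfolding L clan_Exp_sym_arrow unfolding matrix_exp_arrow using pos dd by simp
  also have "\<dots> = sym_arrow (x $ 1 $ 1) (x $ 2 $ 2) (x $ 3 $ 3) (x $ 3 $ 1) (x $ 3 $ 2)"
    unfolding arrow_gram using pos
    by (simp add: sq) (simp add: schur_def sq[symmetric] power2_eq_square field_simps)
  also have "\<dots> = x" using x(1) by (simp add: clan_space_iff)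
  finally show ?thesis .
qed

lemma log_coords_in_clan_space: "log_coords x \<in> clan_space"
  by (simp add: log_coords_def Let_def sym_arrow_in_clan_space)

text \<open>Write \<open>x\<close> as \<open>clan_Exp (log_coords x)\<close> and cancel. Cholesky
  factor and logarithm are thus computed only for matrices given as exponentials.\<close>

lemma clan_Log_eq_coords: "x \<in> clan_cone \<Longrightarrow> clan_Log x = log_coords x"
  using clan_Log_Exp[OF log_coords_in_clan_space, of x] by (simp add: clan_Exp_log_coords)

lemma clan_Log_in_space: "x \<in> clan_cone \<Longrightarrow> clan_Log x \<in> clan_space"
  by (simp add: clan_Log_eq_coords log_coords_in_clan_space)

lemma clan_Exp_Log: "x \<in> clan_cone \<Longrightarrow> clan_Exp (clan_Log x) = x"
  by (simp add: clan_Log_eq_coords clan_Exp_log_coords)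

section \<open>Smoothness of the coordinate maps\<close>

lemma Ck_on_entry:
  fixes f :: "'a::real_normed_vector \<Rightarrow> real^'n^'m"
  assumes "open U" "Ck_on k U f"
  shows "Ck_on k U (\<lambda>x. f x $ i $ j)"
  using Ck_on_bounded_linear[OF assms(1) bounded_linear_vec_nth
      Ck_on_bounded_linear[OF assms(1) bounded_linear_vec_nth assms(2)]] .

lemma Ck_on_nth_nth: "open U \<Longrightarrow> Ck_on k U (\<lambda>x :: real^'n^'m. x $ i $ j)"
  by (intro Ck_on_entry Ck_on_id)

lemma Ck_on_sym_arrow:
  assumes "open U" "Ck_on k U a" "Ck_on k U b" "Ck_on k U c" "Ck_on k U d" "Ck_on k U e"
  shows "Ck_on k U (\<lambda>x. sym_arrow (a x) (b x) (c x) (d x) (e x))"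
proof -
  have "\<forall>i j. Ck_on k U (\<lambda>x. sym_arrow (a x) (b x) (c x) (d x) (e x) $ i $ j)"
    unfolding forall_3 by (simp add: assms Ck_on_const)
  then show ?thesis by (intro Ck_on_vec assms(1)) blast
qed

lemma Ck_on_compose_real:
  fixes f :: "'a::real_normed_vector \<Rightarrow> real"
  assumes "open U" "Ck_on k U f"
  shows "Ck_on k U (\<lambda>x. exp (f x))" "Ck_on k U (\<lambda>x. exp_quot (f x))"
    and "(\<And>x. x \<in> U \<Longrightarrow> f x > 0) \<Longrightarrow> Ck_on k U (\<lambda>x. ln (f x))"
    and "(\<And>x. x \<in> U \<Longrightarrow> f x > 0) \<Longrightarrow> Ck_on k U (\<lambda>x. sqrt (f x))"
    and "(\<And>x. x \<in> U \<Longrightarrow> f x > 0) \<Longrightarrow> Ck_on k U (\<lambda>x. inverse (f x))"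
proof -
  show "Ck_on k U (\<lambda>x. exp (f x))" "Ck_on k U (\<lambda>x. exp_quot (f x))"
    using Ck_on_compose[OF assms(1) Ck_on_exp assms(2)] Ck_on_compose[OF assms(1) Ck_on_exp_quot assms(2)]
    by simp_all
  assume "\<And>x. x \<in> U \<Longrightarrow> f x > 0"
  then have *: "f ` U \<subseteq> {0<..}" "f ` U \<subseteq> - {0}" by force+
  show "Ck_on k U (\<lambda>x. ln (f x))" by (rule Ck_on_compose[OF assms(1) Ck_on_ln assms(2) *(1)])
  show "Ck_on k U (\<lambda>x. sqrt (f x))" by (rule Ck_on_compose[OF assms(1) Ck_on_sqrt assms(2) *(1)])
  show "Ck_on k U (\<lambda>x. inverse (f x))" by (rule Ck_on_compose[OF assms(1) Ck_on_inverse assms(2) *(2)])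
qed

lemma Ck_on_exp_dd:
  fixes f g :: "'a::real_normed_vector \<Rightarrow> real"
  assumes "open U" "Ck_on k U f" "Ck_on k U g"
  shows "Ck_on k U (\<lambda>x. exp_dd (f x) (g x))"
  unfolding exp_dd_def by (intro Ck_on_mult Ck_on_compose_real Ck_on_diff assms)

lemma Ck_on_exp_coords: "Ck_on k UNIV exp_coords"
  unfolding exp_coords_def[abs_def] Let_def
  by (intro Ck_on_sym_arrow Ck_on_mult Ck_on_add Ck_on_compose_real(1) Ck_on_exp_dd Ck_on_nth_nth
      Ck_on_const open_UNIV)

lemma open_pos_diagonal: "open {x :: real^3^3. 0 < x $ 1 $ 1 \<and> 0 < x $ 2 $ 2}"
  by (intro open_Collect_conj open_Collect_less continuous_intros)

lemma Ck_on_schur: "Ck_on k {x. 0 < x $ 1 $ 1 \<and> 0 < x $ 2 $ 2} schur"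
  unfolding schur_def[abs_def] power2_eq_square
  by (intro Ck_on_diff Ck_on_mult Ck_on_compose_real(5) Ck_on_nth_nth open_pos_diagonal) auto

text \<open>Continuity of \<open>schur\<close> is available where the first two diagonal entries are
  positive, so the preimage is taken within that open set.\<close>

lemma open_schur_domain: "open schur_domain"
proof -
  have "continuous_on {x. 0 < x $ 1 $ 1 \<and> 0 < x $ 2 $ 2} schur" using Ck_on_schur[of 0] by simp
  then have "open ({x. 0 < x $ 1 $ 1 \<and> 0 < x $ 2 $ 2} \<inter> schur -` {0<..})"
    by (intro continuous_open_preimage open_pos_diagonal) auto
  also have "{x. 0 < x $ 1 $ 1 \<and> 0 < x $ 2 $ 2} \<inter> schur -` {0<..} = schur_domain"
    by (auto simp: schur_domain_def)
  finally show ?thesis .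
qed

lemma Ck_on_log_coords: "Ck_on k schur_domain log_coords"
proof -
  have "Ck_on k schur_domain schur"
    by (rule Ck_on_subset[OF Ck_on_schur]) (auto simp: schur_domain_def)
  moreover have "x $ 1 $ 1 > 0" "x $ 2 $ 2 > 0" "schur x > 0" if "x \<in> schur_domain" for x
    using that by (auto simp: schur_domain_def)
  ultimately show ?thesis
    unfolding log_coords_def[abs_def] Let_def
    by (intro Ck_on_sym_arrow Ck_on_mult Ck_on_compose_real(3-5) Ck_on_exp_dd Ck_on_nth_nth
        Ck_on_const open_schur_domain exp_dd_pos) simp_all
qed

lemma clan_cone_subset_schur_domain: "clan_cone \<subseteq> schur_domain"
  by (simp add: clan_cone_eq)

section \<open>The Lie group structure\<close>

lemma smooth_map_onI:
  assumes "open U" "S \<subseteq> U" "\<And>k. Ck_on k U g" "\<And>x. x \<in> S \<Longrightarrow> g x = f x"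
  shows "smooth_map_on S f"
  unfolding smooth_map_on_def using assms by blast

lemma clan_add_in_cone: "x \<in> clan_cone \<Longrightarrow> y \<in> clan_cone \<Longrightarrow> clan_add x y \<in> clan_cone"
  unfolding clan_add_def
  by (intro clan_Exp_in_cone subspace_add[OF subspace_clan_space] clan_Log_in_space)

lemma clan_Log_add: "x \<in> clan_cone \<Longrightarrow> y \<in> clan_cone \<Longrightarrow>
    clan_Log (clan_add x y) = clan_Log x + clan_Log y"
  unfolding clan_add_def
  by (intro clan_Log_Exp subspace_add[OF subspace_clan_space] clan_Log_in_space)

lemma clan_inv_in_cone: "x \<in> clan_cone \<Longrightarrow> clan_inv x \<in> clan_cone"
  unfolding clan_inv_def
  by (intro clan_Exp_in_cone subspace_neg[OF subspace_clan_space] clan_Log_in_space)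

lemma clan_Log_inv: "x \<in> clan_cone \<Longrightarrow> clan_Log (clan_inv x) = - clan_Log x"
  unfolding clan_inv_def
  by (intro clan_Log_Exp subspace_neg[OF subspace_clan_space] clan_Log_in_space)

lemma clan_mean_log_in_space: "x \<in> clan_cone \<Longrightarrow> y \<in> clan_cone \<Longrightarrow>
    (1 - t) *\<^sub>R clan_Log x + t *\<^sub>R clan_Log y \<in> clan_space"
  by (intro subspace_add subspace_scale subspace_clan_space clan_Log_in_space)

lemma clan_mean_in_cone: "x \<in> clan_cone \<Longrightarrow> y \<in> clan_cone \<Longrightarrow> clan_mean t x y \<in> clan_cone"
  unfolding clan_mean_def by (intro clan_Exp_in_cone clan_mean_log_in_space)

lemma clan_Log_mean: "x \<in> clan_cone \<Longrightarrow> y \<in> clan_cone \<Longrightarrow>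
    clan_Log (clan_mean t x y) = (1 - t) *\<^sub>R clan_Log x + t *\<^sub>R clan_Log y"
  unfolding clan_mean_def by (intro clan_Log_Exp clan_mean_log_in_space)

text \<open>Turns identities in the cone, such as the group laws, into linear identities between
  logarithms.\<close>

lemma clan_Log_inj: "x \<in> clan_cone \<Longrightarrow> y \<in> clan_cone \<Longrightarrow> clan_Log x = clan_Log y \<Longrightarrow> x = y"
  by (metis clan_Exp_Log)

lemma clan_Exp_0: "clan_Exp 0 = mat 1"
proof -
  have zero: "0 = sym_arrow (2 * 0) (2 * 0) (2 * 0) 0 0" by (simp add: mat3_eq_iff)
  show ?thesis
    unfolding zero clan_Exp_sym_arrow matrix_exp_arrow arrow_gram by (simp add: sym_arrow_one)
qed

lemma mat_1_in_cone: "mat 1 \<in> clan_cone"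
  using clan_Exp_in_cone[OF subspace_0[OF subspace_clan_space]] by (simp add: clan_Exp_0)

lemma clan_Log_mat_1: "clan_Log (mat 1) = 0"
  using clan_Log_Exp[OF subspace_0[OF subspace_clan_space]] by (simp add: clan_Exp_0)

lemma clan_add_inv: "x \<in> clan_cone \<Longrightarrow> clan_add (clan_inv x) x = mat 1"
  by (rule clan_Log_inj)
    (simp_all add: clan_add_in_cone clan_inv_in_cone mat_1_in_cone clan_Log_add clan_Log_inv clan_Log_mat_1)

lemma carrier_clan_groups [simp]:
  "carrier clan_cone_group = clan_cone" "carrier clan_space_group = clan_space"
  by (simp_all add: clan_cone_group_def clan_space_group_def)

lemma comm_group_clan_cone: "comm_group clan_cone_group"
proof (rule comm_groupI)
  show "\<exists>y\<in>carrier clan_cone_group. y \<otimes>\<^bsub>clan_cone_group\<^esub> x = \<one>\<^bsub>clan_cone_group\<^esub>"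
    if "x \<in> carrier clan_cone_group" for x
    using that clan_add_inv clan_inv_in_cone by (auto simp: clan_cone_group_def)
qed (simp_all add: clan_cone_group_def mat_1_in_cone clan_add_in_cone,
    (rule clan_Log_inj; simp add: mat_1_in_cone clan_add_in_cone clan_Log_add clan_Log_mat_1 add_ac)+)

lemma comm_group_clan_space: "comm_group clan_space_group"
proof (rule comm_groupI)
  show "\<exists>y\<in>carrier clan_space_group. y \<otimes>\<^bsub>clan_space_group\<^esub> x = \<one>\<^bsub>clan_space_group\<^esub>"
    if "x \<in> carrier clan_space_group" for x
    using that subspace_neg[OF subspace_clan_space] by (auto simp: clan_space_group_def intro!: bexI[of _ "- x"])
qed (auto simp: clan_space_group_def subspace_0 subspace_add subspace_clan_space add_ac)

lemma inv_clan_cone_group: "x \<in> clan_cone \<Longrightarrow> inv\<^bsub>clan_cone_group\<^esub> x = clan_inv x"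
  using comm_group.axioms(2)[OF comm_group_clan_cone]
  by (intro group.inv_equality) (simp_all add: clan_cone_group_def clan_add_inv clan_inv_in_cone)

lemma inv_clan_space_group: "v \<in> clan_space \<Longrightarrow> inv\<^bsub>clan_space_group\<^esub> v = - v"
  using comm_group.axioms(2)[OF comm_group_clan_space] subspace_neg[OF subspace_clan_space]
  by (intro group.inv_equality) (simp_all add: clan_space_group_def)

section \<open>Smoothness of the group operations and of the isomorphism\<close>

lemma lie_group_clan_cone: "lie_group_in clan_space clan_cone_group"
  unfolding lie_group_in_def
proof (intro conjI)
  show "subspace clan_space" by (rule subspace_clan_space)
  show "openin (top_of_set clan_space) (carrier clan_cone_group)"
    by (simp add: clan_cone_group_def clan_cone_eq openin_open_Int open_schur_domain)
  show "group clan_cone_group" using comm_group_clan_cone by (rule comm_group.axioms)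
  let ?U = "schur_domain \<times> schur_domain :: ((real^3^3) \<times> (real^3^3)) set"
  have U: "open ?U" by (intro open_Times open_schur_domain)
  have smooth: "Ck_on k ?U (\<lambda>z. exp_coords (log_coords (fst z) + log_coords (snd z)))" for k
  proof (intro Ck_on_compose[OF U Ck_on_exp_coords] Ck_on_add U)
    show "Ck_on k ?U (\<lambda>z. log_coords (fst z))"
      by (rule Ck_on_compose[OF U Ck_on_log_coords Ck_on_linear[OF U bounded_linear_fst]]) auto
    show "Ck_on k ?U (\<lambda>z. log_coords (snd z))"
      by (rule Ck_on_compose[OF U Ck_on_log_coords Ck_on_linear[OF U bounded_linear_snd]]) auto
  qed simp
  show "smooth_map_on (carrier clan_cone_group \<times> carrier clan_cone_group)
      (\<lambda>(x, y). x \<otimes>\<^bsub>clan_cone_group\<^esub> y)"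
    by (rule smooth_map_onI[OF U _ smooth])
      (use clan_cone_subset_schur_domain in \<open>auto simp: clan_cone_group_def clan_add_def clan_Log_eq_coords clan_Exp_eq_coords
        subspace_add subspace_clan_space log_coords_in_clan_space\<close>)
  have smooth_inv: "Ck_on k schur_domain (\<lambda>x. exp_coords (- log_coords x))" for k
    by (intro Ck_on_compose[OF open_schur_domain Ck_on_exp_coords] Ck_on_minus Ck_on_log_coords
        open_schur_domain) simp
  show "smooth_map_on (carrier clan_cone_group) (\<lambda>x. inv\<^bsub>clan_cone_group\<^esub> x)"
    by (rule smooth_map_onI[OF open_schur_domain _ smooth_inv])
      (simp_all add: clan_cone_subset_schur_domain inv_clan_cone_group clan_inv_def
        clan_Log_eq_coords clan_Exp_eq_coords subspace_neg subspace_clan_space log_coords_in_clan_space)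
qed

lemma lie_group_clan_space: "lie_group_in clan_space clan_space_group"
  unfolding lie_group_in_def
proof (intro conjI)
  show "subspace clan_space" by (rule subspace_clan_space)
  show "openin (top_of_set clan_space) (carrier clan_space_group)"
    by (simp add: clan_space_group_def)
  show "group clan_space_group" using comm_group_clan_space by (rule comm_group.axioms)
  have smooth: "Ck_on k UNIV (\<lambda>z :: (real^3^3) \<times> (real^3^3). fst z + snd z)" for k
    by (intro Ck_on_add Ck_on_linear bounded_linear_fst bounded_linear_snd open_UNIV)
  show "smooth_map_on (carrier clan_space_group \<times> carrier clan_space_group)
      (\<lambda>(x, y). x \<otimes>\<^bsub>clan_space_group\<^esub> y)"
    by (rule smooth_map_onI[OF open_UNIV _ smooth]) (auto simp: clan_space_group_def)
  have smooth_inv: "Ck_on k UNIV (\<lambda>x :: real^3^3. - x)" for k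
    by (intro Ck_on_minus Ck_on_id open_UNIV)
  show "smooth_map_on (carrier clan_space_group) (\<lambda>x. inv\<^bsub>clan_space_group\<^esub> x)"
    by (rule smooth_map_onI[OF open_UNIV _ smooth_inv]) (simp_all add: inv_clan_space_group)
qed

lemma lie_group_iso_clan_Log:
  "lie_group_iso clan_space clan_cone_group clan_space clan_space_group clan_Log"
  unfolding lie_group_iso_def
proof (intro conjI)
  have bij: "bij_betw clan_Log clan_cone clan_space"
    by (rule bij_betw_byWitness[of _ clan_Exp])
      (auto simp: clan_Exp_Log clan_Log_Exp clan_Log_in_space clan_Exp_in_cone)
  then show "clan_Log \<in> iso clan_cone_group clan_space_group"
    by (intro isoI) (auto simp: hom_def clan_cone_group_def clan_space_group_def clan_Log_in_space clan_Log_add)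
  show "smooth_map_on (carrier clan_cone_group) clan_Log"
    by (rule smooth_map_onI[OF open_schur_domain _ Ck_on_log_coords])
      (simp_all add: clan_cone_subset_schur_domain clan_Log_eq_coords)
  have "inv_into clan_cone clan_Log v = exp_coords v" if "v \<in> clan_space" for v
    using inv_into_f_eq[OF bij_betw_imp_inj_on[OF bij] clan_Exp_in_cone[OF that] clan_Log_Exp[OF that]]
    by (simp only: clan_Exp_eq_coords[OF that])
  then show "smooth_map_on (carrier clan_space_group) (inv_into (carrier clan_cone_group) clan_Log)"
    by (intro smooth_map_onI[OF open_UNIV _ Ck_on_exp_coords]) simp_all
qed (rule lie_group_clan_cone lie_group_clan_space)+

section \<open>Invariance of the distance\<close>

text \<open>The exceptional points stay the same. Continuity of the new velocity follows by
  expanding the old one in \<open>Basis\<close>, as in the chain rule for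
  \<open>Ck_on\<close>.\<close>

lemma piecewise_C1_compose_Ck:
  fixes \<gamma> :: "real \<Rightarrow> 'a::euclidean_space" and F :: "'a \<Rightarrow> 'b::euclidean_space"
  assumes "\<gamma> piecewise_C1_differentiable_on I" "Ck_on 1 U F" "\<gamma> ` I \<subseteq> U"
  shows "(\<lambda>t. F (\<gamma> t)) piecewise_C1_differentiable_on I"
proof -
  have F: "Ck_on (Suc 0) U F" using assms(2) by simp
  have contF: "continuous_on U F" using Ck_on_Suc_imp[OF F] by simp
  from assms(1) obtain S D where S: "finite S" and cont: "continuous_on I \<gamma>"
    and D: "\<And>t. t \<in> I - S \<Longrightarrow> (\<gamma> has_vector_derivative D t) (at t)" and contD: "continuous_on (I - S) D"
    unfolding piecewise_C1_differentiable_on_def C1_differentiable_on_def by blast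
  let ?F' = "\<lambda>t. frechet_derivative F (at (\<gamma> t))"
  have F': "(F has_derivative ?F' t) (at (\<gamma> t))" if "t \<in> I" for t
    using Ck_on_has_derivative[OF F] that assms(3) by blast
  have deriv: "((\<lambda>t. F (\<gamma> t)) has_vector_derivative ?F' t (D t)) (at t)" if "t \<in> I - S" for t
    using vector_derivative_diff_chain_within[OF D[OF that] has_derivative_at_withinI[OF F']] that
    by (simp add: o_def)
  have expand: "(\<Sum>b\<in>Basis. (D t \<bullet> b) *\<^sub>R ?F' t b) = ?F' t (D t)" if "t \<in> I - S" for t
  proof -
    have lin: "linear (?F' t)" by (rule has_derivative_linear[OF F']) (use that in simp)
    show ?thesis
      using linear_sum[OF lin, of "\<lambda>b. (D t \<bullet> b) *\<^sub>R b" Basis]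
      by (simp add: linear_cmul[OF lin] euclidean_representation)
  qed
  have "continuous_on (I - S) (\<lambda>t. ?F' t b)" for b
  proof (rule continuous_on_compose2[of U "\<lambda>x. frechet_derivative F (at x) b"])
    show "continuous_on U (\<lambda>x. frechet_derivative F (at x) b)" using F by simp
    show "continuous_on (I - S) \<gamma>" using cont Diff_subset by (rule continuous_on_subset)
  qed (use assms(3) in auto)
  then have "continuous_on (I - S) (\<lambda>t. \<Sum>b\<in>Basis. (D t \<bullet> b) *\<^sub>R ?F' t b)"
    by (intro continuous_intros contD)
  then have "continuous_on (I - S) (\<lambda>t. ?F' t (D t))"
    by (subst continuous_on_cong[OF refl expand[symmetric]])
  then have "(\<lambda>t. F (\<gamma> t)) C1_differentiable_on (I - S)"
    unfolding C1_differentiable_on_def using deriv by (intro exI[of _ "\<lambda>t. ?F' t (D t)"]) simp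
  moreover have "continuous_on I (\<lambda>t. F (\<gamma> t))"
    by (rule continuous_on_compose2[OF contF cont assms(3)])
  ultimately show ?thesis
    unfolding piecewise_C1_differentiable_on_def using S by blast
qed

text \<open>The derivative of \<open>clan_Log\<close> within the cone is only used along curves in the cone, where the
  chain rule makes the choice involved in \<open>frechet_derivative\<close> immaterial.\<close>

lemma clan_Log_curve_derivative:
  assumes "\<And>s. s \<in> {0<..<1} \<Longrightarrow> \<gamma> s \<in> clan_cone" "t \<in> {0<..<1}"
    and "(\<gamma> has_vector_derivative v) (at t)"
  shows "((\<lambda>s. clan_Log (\<gamma> s)) has_vector_derivative
    frechet_derivative clan_Log (at (\<gamma> t) within clan_cone) v) (at t)"
proof -
  let ?C = clan_cone and ?I = "{0<..<1::real}"
  have t: "\<gamma> t \<in> ?C" using assms by blast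
  have "(log_coords has_derivative frechet_derivative log_coords (at (\<gamma> t))) (at (\<gamma> t) within ?C)"
    using Ck_on_has_derivative[OF Ck_on_log_coords] t clan_cone_subset_schur_domain
    by (blast intro: has_derivative_at_withinI)
  then have "(clan_Log has_derivative frechet_derivative log_coords (at (\<gamma> t))) (at (\<gamma> t) within ?C)"
    by (rule has_derivative_transform[rotated 2]) (simp_all add: t clan_Log_eq_coords)
  then have "(clan_Log has_derivative frechet_derivative clan_Log (at (\<gamma> t) within ?C)) (at (\<gamma> t) within ?C)"
    using differentiableI frechet_derivative_works by blast
  \<comment> \<open>The chain rule requires a derivative within the image of the curve. As
    \<open>?I\<close> is open, the resulting derivative within \<open>?I\<close> is a full
    one.\<close>
  then have "(clan_Log has_derivative frechet_derivative clan_Log (at (\<gamma> t) within ?C)) (at (\<gamma> t) within \<gamma> ` ?I)"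
    by (rule has_derivative_subset) (use assms(1) in blast)
  from vector_derivative_diff_chain_within[OF has_vector_derivative_at_within[OF assms(3)] this]
  show ?thesis
    using at_within_open[OF assms(2)] by (simp add: o_def)
qed

lemma clan_metric_curve:
  assumes "\<And>s. s \<in> {0<..<1} \<Longrightarrow> \<gamma> s \<in> clan_cone" "t \<in> {0<..<1}" "\<gamma> differentiable (at t)"
  defines "w \<equiv> vector_derivative (\<lambda>s. clan_Log (\<gamma> s)) (at t)"
  shows "((\<lambda>s. clan_Log (\<gamma> s)) has_vector_derivative w) (at t)"
    and "clan_metric (\<gamma> t) (vector_derivative \<gamma> (at t)) (vector_derivative \<gamma> (at t)) = clan_Q w w"
proof -
  have *: "((\<lambda>s. clan_Log (\<gamma> s)) has_vector_derivative
      frechet_derivative clan_Log (at (\<gamma> t) within clan_cone) (vector_derivative \<gamma> (at t))) (at t)"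
    using assms by (intro clan_Log_curve_derivative) (simp_all add: vector_derivative_works[symmetric])
  have w: "w = frechet_derivative clan_Log (at (\<gamma> t) within clan_cone) (vector_derivative \<gamma> (at t))"
    unfolding w_def by (rule vector_derivative_at[OF *])
  show "((\<lambda>s. clan_Log (\<gamma> s)) has_vector_derivative w) (at t)" using * by (simp only: w)
  show "clan_metric (\<gamma> t) (vector_derivative \<gamma> (at t)) (vector_derivative \<gamma> (at t)) = clan_Q w w"
    by (simp add: clan_metric_def w)
qed

abbreviation clan_lengths :: "real^3^3 \<Rightarrow> real^3^3 \<Rightarrow> real set" where
  "clan_lengths x y \<equiv> {l. \<exists>\<gamma>.
     \<gamma> piecewise_C1_differentiable_on {0..1} \<and> path_image \<gamma> \<subseteq> clan_cone \<and>
     pathstart \<gamma> = x \<and> pathfinish \<gamma> = y \<and>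
     ((\<lambda>t. sqrt (clan_metric (\<gamma> t) (vector_derivative \<gamma> (at t)) (vector_derivative \<gamma> (at t))))
        has_integral l) {0..1}}"

lemma clan_lengths_add:
  assumes a: "a \<in> clan_cone"
  shows "clan_lengths x y \<subseteq> clan_lengths (clan_add a x) (clan_add a y)"
proof clarify
  fix l \<gamma>
  assume C1: "\<gamma> piecewise_C1_differentiable_on {0..1}" and im: "path_image \<gamma> \<subseteq> clan_cone"
    and int: "((\<lambda>t. sqrt (clan_metric (\<gamma> t) (vector_derivative \<gamma> (at t)) (vector_derivative \<gamma> (at t))))
        has_integral l) {0..1}"
  \<comment> \<open>An extension of the translation by \<open>a\<close> that is smooth on the open
    set \<open>schur_domain\<close>, as the composition with a piecewise \<open>C1\<close> curve
    requires.\<close>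
  define F where "F x = exp_coords (log_coords a + log_coords x)" for x
  define \<delta> where "\<delta> t = F (\<gamma> t)" for t
  have F: "F x = clan_add a x" if "x \<in> clan_cone" for x
    using that a by (simp add: F_def clan_add_def clan_Log_eq_coords clan_Exp_eq_coords
        subspace_add subspace_clan_space log_coords_in_clan_space)
  have \<gamma>: "\<gamma> t \<in> clan_cone" if "t \<in> {0..1}" for t using im that by (auto simp: path_image_def)
  then have \<delta>: "\<delta> t = clan_add a (\<gamma> t)" "\<delta> t \<in> clan_cone" if "t \<in> {0..1}" for t
    using that a by (simp_all add: \<delta>_def F clan_add_in_cone)
  have "Ck_on 1 schur_domain F"
    unfolding F_def[abs_def]
    by (intro Ck_on_compose[OF open_schur_domain Ck_on_exp_coords] Ck_on_add Ck_on_const Ck_on_log_coords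
        open_schur_domain) simp
  then have C1': "\<delta> piecewise_C1_differentiable_on {0..1}"
    unfolding \<delta>_def[abs_def] using \<gamma> clan_cone_subset_schur_domain
    by (intro piecewise_C1_compose_Ck[OF C1]) auto
  obtain S where S: "finite S" "\<And>t. t \<in> {0..1} - S \<Longrightarrow> \<gamma> differentiable (at t)"
    using C1 unfolding piecewise_C1_differentiable_on_def C1_differentiable_on_eq by blast
  obtain S' where S': "finite S'" "\<And>t. t \<in> {0..1} - S' \<Longrightarrow> \<delta> differentiable (at t)"
    using C1' unfolding piecewise_C1_differentiable_on_def C1_differentiable_on_eq by blast
  have "((\<lambda>t. sqrt (clan_metric (\<delta> t) (vector_derivative \<delta> (at t)) (vector_derivative \<delta> (at t))))
      has_integral l) {0..1}"
  proof (rule has_integral_spike_finite[OF _ _ int])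
    \<comment> \<open>The endpoints are discarded as well: the curves may leave the cone outside the
      unit interval, where the formula for \<open>clan_Log\<close> along them is lost.\<close>
    show "finite (S \<union> S' \<union> {0, 1})" using S S' by simp
    fix t :: real assume "t \<in> {0..1} - (S \<union> S' \<union> {0, 1})"
    then have t: "t \<in> {0<..<1}" "\<gamma> differentiable (at t)" "\<delta> differentiable (at t)" using S S' by auto
    let ?v = "vector_derivative (\<lambda>s. clan_Log (\<gamma> s)) (at t)"
    have in_cone: "\<gamma> s \<in> clan_cone" "\<delta> s \<in> clan_cone" if "s \<in> {0<..<1}" for s
      using that \<gamma> \<delta> by simp_all
    have "((\<lambda>s. clan_Log a + clan_Log (\<gamma> s)) has_vector_derivative 0 + ?v) (at t)"
      by (intro has_vector_derivative_add has_vector_derivative_const clan_metric_curve(1)[OF in_cone(1) t(1,2)])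
    then have "((\<lambda>s. clan_Log (\<delta> s)) has_vector_derivative 0 + ?v) (at t)"
      by (rule has_vector_derivative_transform_within_open[OF _ open_greaterThanLessThan t(1)])
        (simp add: \<delta> \<gamma> a clan_Log_add)
    from vector_derivative_at[OF this] have "vector_derivative (\<lambda>s. clan_Log (\<delta> s)) (at t) = ?v"
      by simp
    then show "sqrt (clan_metric (\<delta> t) (vector_derivative \<delta> (at t)) (vector_derivative \<delta> (at t))) =
        sqrt (clan_metric (\<gamma> t) (vector_derivative \<gamma> (at t)) (vector_derivative \<gamma> (at t)))"
      by (simp only: clan_metric_curve(2)[OF in_cone(1) t(1,2)] clan_metric_curve(2)[OF in_cone(2) t(1,3)])
  qed
  moreover have "pathstart \<delta> = clan_add a (pathstart \<gamma>)" "pathfinish \<delta> = clan_add a (pathfinish \<gamma>)"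
    by (simp_all add: pathstart_def pathfinish_def \<delta>)
  moreover have "path_image \<delta> \<subseteq> clan_cone" using \<delta> by (auto simp: path_image_def)
  ultimately show "\<exists>\<delta>. \<delta> piecewise_C1_differentiable_on {0..1} \<and> path_image \<delta> \<subseteq> clan_cone \<and>
     pathstart \<delta> = clan_add a (pathstart \<gamma>) \<and> pathfinish \<delta> = clan_add a (pathfinish \<gamma>) \<and>
     ((\<lambda>t. sqrt (clan_metric (\<delta> t) (vector_derivative \<delta> (at t)) (vector_derivative \<delta> (at t))))
        has_integral l) {0..1}"
    using C1' by (intro exI[of _ \<delta>] conjI)
qed

text \<open>Translating by \<open>clan_inv a\<close> gives the reverse inclusion, so both distances
  are infima of the same set of lengths.\<close>

lemma clan_dist_add:
  assumes "a \<in> clan_cone" "x \<in> clan_cone" "y \<in> clan_cone"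
  shows "clan_dist (clan_add a x) (clan_add a y) = clan_dist x y"
proof -
  have cancel: "clan_add (clan_inv a) (clan_add a z) = z" if "z \<in> clan_cone" for z
    by (rule clan_Log_inj) (simp_all add: that assms(1) clan_add_in_cone clan_inv_in_cone clan_Log_add clan_Log_inv)
  have "clan_lengths (clan_add a x) (clan_add a y) \<subseteq> clan_lengths x y"
    using clan_lengths_add[OF clan_inv_in_cone[OF assms(1)], of "clan_add a x" "clan_add a y"]
    unfolding cancel[OF assms(2)] cancel[OF assms(3)] .
  then have "clan_lengths (clan_add a x) (clan_add a y) = clan_lengths x y"
    using clan_lengths_add[OF assms(1), of x y] by (rule subset_antisym)
  then show ?thesis unfolding clan_dist_def riemannian_dist_def by (rule arg_cong)
qed

theorem proposition7p18:
  shows "abelian_lie_group_in clan_space clan_cone_group \<and>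
    lie_group_iso clan_space clan_cone_group clan_space clan_space_group clan_Log \<and>
    (\<forall>a\<in>clan_cone. \<forall>x\<in>clan_cone. \<forall>y\<in>clan_cone. \<forall>t::real. 0 \<le> t \<and> t \<le> 1 \<longrightarrow>
       clan_add a (clan_mean t x y) = clan_mean t (clan_add a x) (clan_add a y) \<and>
       clan_dist (clan_add a x) (clan_add a y) = clan_dist x y \<and>
       clan_inv (clan_mean t x y) = clan_mean t (clan_inv x) (clan_inv y))"
proof (intro conjI ballI allI impI)
  show "abelian_lie_group_in clan_space clan_cone_group"
    by (simp add: abelian_lie_group_in_def lie_group_clan_cone comm_group_clan_cone)
  show "lie_group_iso clan_space clan_cone_group clan_space clan_space_group clan_Log"
    by (rule lie_group_iso_clan_Log)
  fix a x y :: "real^3^3" and t :: real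
  assume *: "a \<in> clan_cone" "x \<in> clan_cone" "y \<in> clan_cone"
  show "clan_add a (clan_mean t x y) = clan_mean t (clan_add a x) (clan_add a y)"
    by (rule clan_Log_inj)
      (simp_all add: * clan_add_in_cone clan_mean_in_cone clan_Log_add clan_Log_mean algebra_simps)
  show "clan_dist (clan_add a x) (clan_add a y) = clan_dist x y"
    using * by (rule clan_dist_add)
  show "clan_inv (clan_mean t x y) = clan_mean t (clan_inv x) (clan_inv y)"
    by (rule clan_Log_inj)
      (simp_all add: * clan_inv_in_cone clan_mean_in_cone clan_Log_inv clan_Log_mean)
qed

end
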